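(* Let $\lambda_1,\lambda_2\in\mathbb C^\times$, $\epsilon_1,\epsilon_2\in\{+,-\}$ (identified with $\pm1$) and $z=\lambda_2/\lambda_1$. The $R$-matrix on $W_1(\lambda_1)^{\epsilon_1}\otimes W_1(\lambda_2)^{\epsilon_2}$ is, up to a scalar, given in the basis $v_0\otimes v_0,\ v_0\otimes v_1,\ v_1\otimes v_0,\ v_1\otimes v_1$ by $$\mathbf R\simeq\begin{pmatrix}1-z^2q_*^2&0&0&0\\0&\epsilon_1q_*(1-z^2)&\epsilon_2z(1-q_*^2)&0\\0&\epsilon_1z(1-q_*^2)&\epsilon_2q_*(1-z^2)&0\\0&0&0&-\epsilon_1\epsilon_2(1-z^2q_*^2)\end{pmatrix}.$$ Alternatively, with $\lambda_i=e^{x_i}$, up to a scalar, $$\mathbf R\simeq\begin{pmatrix}\sinh(x_1-x_2-\ln q_* )&0&0&0\\0&\epsilon_1\sinh(x_1-x_2)&-\epsilon_2\sinh(\ln q_* )&0\\0&-\epsilon_1\sinh(\ln q_* )&\epsilon_2\sinh(x_1-x_2)&0\\0&0&0&-\epsilon_1\epsilon_2\sinh(x_1-x_2-\ln q_* )\end{pmatrix}.$$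
   Context: $q\in\mathbb C^\times$, $q_*:=-iq$, $q_*$ not a root of unity. $U_q(C^{(2)}(2))$ is the Hopf superalgebra with odd generators $\mathcal E_i,\mathcal F_i$ and even invertible $\mathcal K_i$, $i=0,1$, with $\mathcal K_i\mathcal E_j=q^{a_{ij}}\mathcal E_j\mathcal K_i$, $\mathcal K_i\mathcal F_j=q^{-a_{ij}}\mathcal F_j\mathcal K_i$, $(a_{ij})=\begin{pmatrix}2&-2\\-2&2\end{pmatrix}$, $\mathcal E_i\mathcal F_j+\mathcal F_j\mathcal E_i=\delta_{ij}\frac{\mathcal K_i-\mathcal K_i^{-1}}{q+q^{-1}}$, Serre relations, and coproduct $\Delta(\mathcal E_i)=\mathcal E_i\otimes\mathcal K_i+1\otimes\mathcal E_i$, $\Delta(\mathcal F_i)=\mathcal F_i\otimes1+\mathcal K_i^{-1}\otimes\mathcal F_i$, $\Delta(\mathcal K_i)=\mathcal K_i\otimes\mathcal K_i$. $\Delta^{op}$ is $\Delta$ followed by the super flip; tensor products are super: $(A\otimes B)(v\otimes w)=(-1)^{|B||v|}Av\otimes Bw$. $W_1(\lambda)^{\epsilon}$ is the two-dimensional evaluation module with basis $v_0=e^{1/2}_{1/2,\epsilon}$, $v_1=e^{1/2}_{-1/2,-\epsilon}$, where a vector with second subscript $+$ is even and with second subscript $-$ is odd. The action is $\mathcal E_1v_1=\lambda v_0$, $\mathcal E_1v_0=0$, $\mathcal E_0v_0=\lambda v_1$, $\mathcal E_0v_1=0$, $\mathcal F_1v_0=-i\epsilon\lambda^{-1}v_1$,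 $\mathcal F_1v_1=0$, $\mathcal F_0v_1=i\epsilon\lambda^{-1}v_0$, $\mathcal F_0v_0=0$, $\mathcal K_1v_0=\epsilon q_*v_0$, $\mathcal K_1v_1=-\epsilon q_*^{-1}v_1$, $\mathcal K_0=\mathcal K_1^{-1}$. The $R$-matrix on $W_1(\lambda_1)^{\epsilon_1}\otimes W_1(\lambda_2)^{\epsilon_2}$ means a nonzero linear operator $\mathbf R$ on this space with $\Delta^{op}(X)\mathbf R=\mathbf R\Delta(X)$ for all $X\in U_q(C^{(2)}(2))$. Matrices act on column vectors of coordinates (columns are images of basis vectors). *)

theory Defs
  imports
    "HOL-Analysis.Analysis"
    "HOL-Algebra.QuotRing"
    "HOL-Library.Poly_Mapping"
    "HOL-Library.Z2"
begin

text \<open>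
  The type \<^typ>\<open>bit\<close> (the integers mod 2) serves as the index set {0,1} of the generators, as the
  index set of the basis (v_0, v_1) of the evaluation module, and as the group of parities
  (0 = even, 1 = odd).
\<close>

lemma UNIV_bit: "(UNIV :: bit set) = {0, 1}"
  by (auto intro: bit.exhaust)

instance bit :: finite
  by standard (simp add: UNIV_bit)

text \<open>Words form a monoid under concatenation, so that \<^typ>\<open>'g list \<Rightarrow>\<^sub>0 complex\<close>, with the
  convolution product of the library, is the free associative unital algebra on \<^typ>\<open>'g\<close>.\<close>

instantiation list :: (type) monoid_add
begin
definition zero_list :: "'a list" where "zero_list = []"
definition plus_list :: "'a list \<Rightarrow> 'a list \<Rightarrow> 'a list" where "plus_list = (@)"
instance by standard (simp_all add: zero_list_def plus_list_def)
end

definition qstar :: "complex \<Rightarrow> complex" where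
  "qstar q = - \<i> * q"

text \<open>(-1) to the power p r.\<close>
definition super_sign :: "bit \<Rightarrow> bit \<Rightarrow> complex" where
  "super_sign p r = (if p = 1 \<and> r = 1 then -1 else 1)"


section \<open>The superalgebra\<close>

datatype gen = E bit | F bit | K bit | Kinv bit

primrec gen_parity :: "gen \<Rightarrow> bit" where
  "gen_parity (E i) = 1"
| "gen_parity (F i) = 1"
| "gen_parity (K i) = 0"
| "gen_parity (Kinv i) = 0"

definition word_parity :: "gen list \<Rightarrow> bit" where
  "word_parity w = sum_list (map gen_parity w)"

type_synonym free_alg = "gen list \<Rightarrow>\<^sub>0 complex"

definition gn :: "gen \<Rightarrow> free_alg" where
  "gn g = Poly_Mapping.single [g] 1"

definition scal :: "complex \<Rightarrow> free_alg" where
  "scal c = Poly_Mapping.single [] c"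

definition cartan :: "bit \<Rightarrow> bit \<Rightarrow> int" where
  "cartan i j = (if i = j then 2 else -2)"

definition qcomm :: "complex \<Rightarrow> free_alg \<Rightarrow> free_alg \<Rightarrow> free_alg" where
  "qcomm c x y = x * y - scal c * (y * x)"

text \<open>
  The Serre relations are [X_i, [X_i, [X_i, X_j]_q]_q]_q = 0 for X = E, F and i, j distinct, where
  [x, y]_q = x y - (-1)^{|x||y|} q^{(wt x, wt y)} y x.  The successive pairings of weights are
  -2, 0, 2 and the successive second arguments are odd, even, odd, hence the coefficients
  - q^(-2), 1, - q^2 below.  (Replacing q by its inverse gives the same element.)
\<close>
definition serre :: "complex \<Rightarrow> free_alg \<Rightarrow> free_alg \<Rightarrow> free_alg" where
  "serre q x y = qcomm (- (q powi 2)) x (qcomm 1 x (qcomm (- (q powi (-2))) x y))"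

definition uq_relations :: "complex \<Rightarrow> free_alg set" where
  "uq_relations q =
     {gn (K i) * gn (Kinv i) - 1 | i. True}
   \<union> {gn (Kinv i) * gn (K i) - 1 | i. True}
   \<union> {gn (K i) * gn (K j) - gn (K j) * gn (K i) | i j. True}
   \<union> {gn (K i) * gn (E j) - scal (q powi cartan i j) * (gn (E j) * gn (K i)) | i j. True}
   \<union> {gn (K i) * gn (F j) - scal (q powi (- cartan i j)) * (gn (F j) * gn (K i)) | i j. True}
   \<union> {gn (E i) * gn (F j) + gn (F j) * gn (E i)
        - (if i = j then scal (1 / (q + inverse q)) * (gn (K i) - gn (Kinv i)) else 0) | i j. True}
   \<union> {serre q (gn (E i)) (gn (E j)) | i j. i \<noteq> j}
   \<union> {serre q (gn (F i)) (gn (F j)) | i j. i \<noteq> j}"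

definition free_ring :: "free_alg ring" where
  "free_ring = \<lparr>carrier = UNIV, mult = (*), one = 1, zero = 0, add = (+)\<rparr>"

lemma ring_free_ring: "ring free_ring"
proof (rule ringI)
  show "abelian_group free_ring"
  proof (rule abelian_groupI)
    fix x assume "x \<in> carrier free_ring"
    have "(- x) \<oplus>\<^bsub>free_ring\<^esub> x = \<zero>\<^bsub>free_ring\<^esub>"
      by (simp add: free_ring_def)
    then show "\<exists>y\<in>carrier free_ring. y \<oplus>\<^bsub>free_ring\<^esub> x = \<zero>\<^bsub>free_ring\<^esub>"
      by (intro bexI[of _ "- x"]) (simp_all add: free_ring_def)
  qed (simp_all add: free_ring_def add_ac)
  show "Group.monoid free_ring"
    by (rule monoidI) (simp_all add: free_ring_def mult.assoc)
qed (simp_all add: free_ring_def algebra_simps)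

definition uq_ideal :: "complex \<Rightarrow> free_alg set" where
  "uq_ideal q = Idl\<^bsub>free_ring\<^esub> (uq_relations q)"

text \<open>The algebra U_q; its elements are the cosets of the two-sided ideal of relations.\<close>
definition uq :: "complex \<Rightarrow> free_alg set ring" where
  "uq q = free_ring Quot (uq_ideal q)"


section \<open>The super tensor square and the coproduct\<close>

type_synonym free_alg2 = "(gen list \<times> gen list) \<Rightarrow>\<^sub>0 complex"

text \<open>
  \<^typ>\<open>free_alg2\<close> is the tensor square of the free algebra, (a, b) standing for the tensor product
  of the words a and b.  The library product of this type is not used, since it carries no signs.
\<close>

definition tscale :: "complex \<Rightarrow> free_alg2 \<Rightarrow> free_alg2" where
  "tscale c t = Poly_Mapping.map ((*) c) t"

lemma lookup_tscale: "Poly_Mapping.lookup (tscale c t) k = c * Poly_Mapping.lookup t k"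
  by (simp add: tscale_def Poly_Mapping.map.rep_eq when_def)

lemma module_tscale: "module tscale"
  by standard (auto intro!: poly_mapping_eqI simp: lookup_tscale lookup_add algebra_simps)

definition tens :: "free_alg \<Rightarrow> free_alg \<Rightarrow> free_alg2" where
  "tens x y = (\<Sum>a\<in>Poly_Mapping.keys x. \<Sum>b\<in>Poly_Mapping.keys y.
     Poly_Mapping.single (a, b) (Poly_Mapping.lookup x a * Poly_Mapping.lookup y b))"

text \<open>Super product: (a \<otimes> b) (c \<otimes> d) = (-1)^{|b||c|} ac \<otimes> bd.\<close>
definition tmult :: "free_alg2 \<Rightarrow> free_alg2 \<Rightarrow> free_alg2" where
  "tmult s t = (\<Sum>(a, b)\<in>Poly_Mapping.keys s. \<Sum>(c, d)\<in>Poly_Mapping.keys t.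
     Poly_Mapping.single (a @ c, b @ d)
       (super_sign (word_parity b) (word_parity c)
          * Poly_Mapping.lookup s (a, b) * Poly_Mapping.lookup t (c, d)))"

text \<open>Super flip: a \<otimes> b is sent to (-1)^{|a||b|} b \<otimes> a.\<close>
definition super_flip :: "free_alg2 \<Rightarrow> free_alg2" where
  "super_flip t = (\<Sum>(a, b)\<in>Poly_Mapping.keys t.
     Poly_Mapping.single (b, a)
       (super_sign (word_parity a) (word_parity b) * Poly_Mapping.lookup t (a, b)))"

primrec coprod_gen :: "gen \<Rightarrow> free_alg2" where
  "coprod_gen (E i) = tens (gn (E i)) (gn (K i)) + tens 1 (gn (E i))"
| "coprod_gen (F i) = tens (gn (F i)) 1 + tens (gn (Kinv i)) (gn (F i))"
| "coprod_gen (K i) = tens (gn (K i)) (gn (K i))"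
| "coprod_gen (Kinv i) = tens (gn (Kinv i)) (gn (Kinv i))"

primrec coprod_word :: "gen list \<Rightarrow> free_alg2" where
  "coprod_word [] = tens 1 1"
| "coprod_word (g # w) = tmult (coprod_gen g) (coprod_word w)"

definition coprod_free :: "free_alg \<Rightarrow> free_alg2" where
  "coprod_free x =
     (\<Sum>w\<in>Poly_Mapping.keys x. tscale (Poly_Mapping.lookup x w) (coprod_word w))"

text \<open>
  With I = \<^term>\<open>uq_ideal q\<close> and A the free algebra, this is I \<otimes> A + A \<otimes> I, the kernel of the
  projection of A \<otimes> A onto the tensor square of U_q = A / I; the elements of that tensor
  square are represented by the cosets \<^term>\<open>tensor_coset q t\<close> below.
\<close>
definition tensor_ideal :: "complex \<Rightarrow> free_alg2 set" where
  "tensor_ideal q = module.span tscale {tens x y | x y. x \<in> uq_ideal q \<or> y \<in> uq_ideal q}"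

definition tensor_coset :: "complex \<Rightarrow> free_alg2 \<Rightarrow> free_alg2 set" where
  "tensor_coset q t = {t'. t' - t \<in> tensor_ideal q}"

text \<open>
  For X in U_q, the coset of \<^term>\<open>coprod_free x\<close> does not depend on the representative x of X,
  so the union is this common coset.
\<close>
definition coproduct :: "complex \<Rightarrow> free_alg set \<Rightarrow> free_alg2 set" where
  "coproduct q X = (\<Union>x\<in>X. tensor_coset q (coprod_free x))"

definition coproduct_op :: "complex \<Rightarrow> free_alg set \<Rightarrow> free_alg2 set" where
  "coproduct_op q X = super_flip ` coproduct q X"


section \<open>Evaluation modules and their super tensor products\<close>

text \<open>The vector v_j, as a coordinate column.\<close>
definition bvec :: "bit \<Rightarrow> complex ^ bit" where
  "bvec j = axis j 1"

text \<open>
  v_0 has sign subscript \<epsilon> and v_1 has sign subscript -\<epsilon>; a vector is even if this sign is +.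
\<close>
definition v_parity :: "complex \<Rightarrow> bit \<Rightarrow> bit" where
  "v_parity \<epsilon> j = (if (if j = 0 then \<epsilon> else - \<epsilon>) = 1 then 0 else 1)"

text \<open>\<^term>\<open>ev_image q l \<epsilon> g j\<close> is the image of v_j under the generator g in W_1(l)^\<epsilon>.\<close>
primrec ev_image :: "complex \<Rightarrow> complex \<Rightarrow> complex \<Rightarrow> gen \<Rightarrow> bit \<Rightarrow> complex ^ bit" where
  "ev_image q l \<epsilon> (E i) j =
     (if i = 1 \<and> j = 1 then l *s bvec 0
      else if i = 0 \<and> j = 0 then l *s bvec 1
      else 0)"
| "ev_image q l \<epsilon> (F i) j =
     (if i = 1 \<and> j = 0 then (- \<i> * \<epsilon> * inverse l) *s bvec 1
      else if i = 0 \<and> j = 1 then (\<i> * \<epsilon> * inverse l) *s bvec 0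
      else 0)"
| "ev_image q l \<epsilon> (K i) j =
     (let k = (if j = 0 then \<epsilon> * qstar q else - \<epsilon> * inverse (qstar q))
      in (if i = 1 then k else inverse k) *s bvec j)"
| "ev_image q l \<epsilon> (Kinv i) j =
     (let k = (if j = 0 then \<epsilon> * qstar q else - \<epsilon> * inverse (qstar q))
      in (if i = 1 then inverse k else k) *s bvec j)"

definition ev_gen :: "complex \<Rightarrow> complex \<Rightarrow> complex \<Rightarrow> gen \<Rightarrow> complex ^ bit ^ bit" where
  "ev_gen q l \<epsilon> g = (\<chi> r c. ev_image q l \<epsilon> g c $ r)"

primrec ev_word :: "complex \<Rightarrow> complex \<Rightarrow> complex \<Rightarrow> gen list \<Rightarrow> complex ^ bit ^ bit" where
  "ev_word q l \<epsilon> [] = mat 1"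
| "ev_word q l \<epsilon> (g # w) = ev_gen q l \<epsilon> g ** ev_word q l \<epsilon> w"

text \<open>
  \<^term>\<open>super_tensor \<epsilon> p A B\<close> is the matrix of A \<otimes> B, for B of parity p, acting on
  W_1(l)^\<epsilon> \<otimes> W_1(l')^\<epsilon>': (A \<otimes> B)(v_i \<otimes> v_j) = (-1)^{p |v_i|} A v_i \<otimes> B v_j,
  where the coordinate (i, j) belongs to v_i \<otimes> v_j.
\<close>
definition super_tensor ::
  "complex \<Rightarrow> bit \<Rightarrow> complex ^ bit ^ bit \<Rightarrow> complex ^ bit ^ bit \<Rightarrow> complex ^ (bit \<times> bit) ^ (bit \<times> bit)"
where
  "super_tensor \<epsilon> p A B =
     (\<chi> r c. super_sign p (v_parity \<epsilon> (fst c)) * (A $ fst r $ fst c) * (B $ snd r $ snd c))"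

text \<open>
  Operator by which an element of the tensor square of the free algebra acts on
  W_1(l1)^\<epsilon>1 \<otimes> W_1(l2)^\<epsilon>2.
\<close>
definition tensor_action_free ::
  "complex \<Rightarrow> complex \<Rightarrow> complex \<Rightarrow> complex \<Rightarrow> complex \<Rightarrow> free_alg2 \<Rightarrow> complex ^ (bit \<times> bit) ^ (bit \<times> bit)"
where
  "tensor_action_free q l1 \<epsilon>1 l2 \<epsilon>2 t =
     (\<chi> r c. \<Sum>(a, b)\<in>Poly_Mapping.keys t. Poly_Mapping.lookup t (a, b) *
        (super_tensor \<epsilon>1 (word_parity b) (ev_word q l1 \<epsilon>1 a) (ev_word q l2 \<epsilon>2 b) $ r $ c))"

text \<open>
  Action of a coset: all its representatives act by the same operator, because the relations
  of U_q hold in both evaluation modules.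
\<close>
definition tensor_action ::
  "complex \<Rightarrow> complex \<Rightarrow> complex \<Rightarrow> complex \<Rightarrow> complex \<Rightarrow> free_alg2 set \<Rightarrow> complex ^ (bit \<times> bit) ^ (bit \<times> bit)"
where
  "tensor_action q l1 \<epsilon>1 l2 \<epsilon>2 T = the_elem (tensor_action_free q l1 \<epsilon>1 l2 \<epsilon>2 ` T)"

definition is_R_matrix ::
  "complex \<Rightarrow> complex \<Rightarrow> complex \<Rightarrow> complex \<Rightarrow> complex
     \<Rightarrow> (complex ^ (bit \<times> bit) \<Rightarrow> complex ^ (bit \<times> bit)) \<Rightarrow> bool"
where
  "is_R_matrix q l1 \<epsilon>1 l2 \<epsilon>2 R \<longleftrightarrow>
     Vector_Spaces.linear (*s) (*s) R \<and> R \<noteq> (\<lambda>_. 0) \<and>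
     (\<forall>X \<in> carrier (uq q). \<forall>u.
        tensor_action q l1 \<epsilon>1 l2 \<epsilon>2 (coproduct_op q X) *v R u
        = R (tensor_action q l1 \<epsilon>1 l2 \<epsilon>2 (coproduct q X) *v u))"

text \<open>Position in the ordered basis v_0 \<otimes> v_0, v_0 \<otimes> v_1, v_1 \<otimes> v_0, v_1 \<otimes> v_1.\<close>
definition basis_pos :: "bit \<times> bit \<Rightarrow> nat" where
  "basis_pos p = (if fst p = 0 then 0 else 2) + (if snd p = 0 then 0 else 1)"

definition mat_of_rows4 :: "complex list list \<Rightarrow> complex ^ (bit \<times> bit) ^ (bit \<times> bit)" where
  "mat_of_rows4 M = (\<chi> r c. M ! basis_pos r ! basis_pos c)"

definition equal_up_to_scalar ::
  "(complex ^ (bit \<times> bit) \<Rightarrow> complex ^ (bit \<times> bit)) \<Rightarrow> complex ^ (bit \<times> bit) ^ (bit \<times> bit) \<Rightarrow> bool"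
where
  "equal_up_to_scalar R M \<longleftrightarrow> (\<exists>c. c \<noteq> 0 \<and> (\<forall>u. R u = c *s (M *v u)))"

end

theory Submission
  imports Defs
begin

text \<open>
  The evaluation modules and their super tensor products satisfy the defining relations, so the action
  of \<open>\<Delta>(X)\<close> is independent of all choices and multiplicative in \<open>X\<close>, while \<open>\<Delta>\<^sup>o\<^sup>p(X)\<close> acts as the
  conjugate, by the super flip, of the action of \<open>\<Delta>(X)\<close> on the tensor product in the opposite order.
  Hence an R-matrix is a nonzero matrix that intertwines the action of the generators.  For \<open>\<K>\<^sub>1\<close> this
  forces weight preservation, because \<open>q\<^sub>*\<^sup>2\<close>, \<open>-1\<close> and \<open>q\<^sub>*\<^sup>-\<^sup>2\<close> are distinct; the equations for \<open>\<E>\<^sub>1\<close> and \<open>\<E>\<^sub>0\<close>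
  then form a linear system in six unknowns whose solution space is a line, also at the values of \<open>z\<close>
  for which the tensor product is reducible.
\<close>

text \<open>Parities are added in the group of order two; rewriting \<open>+\<close> on
  \<open>bit\<close> to exclusive or would hide the sums that the lemmas on signs and parities
  match.\<close>

declare add_bit_eq_xor [simp del]

section \<open>Linear extension and representations of the free algebra\<close>

text \<open>A finitely supported function is a finite sum of singles, so linear identities reduce to
  basis elements. The zero function needs no case of its own, being a single with coefficient
  0.\<close>

lemma poly_mapping_add_induct [case_names single add]:
  fixes x :: "'k \<Rightarrow>\<^sub>0 'b::comm_monoid_add"
  assumes "\<And>k c. P (Poly_Mapping.single k c)"
    and "\<And>x y. P x \<Longrightarrow> P y \<Longrightarrow> P (x + y)"
  shows "P x"
proof -
  have zero: "P 0"
    using assms(1)[of undefined 0] by simp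
  have sums: "finite A \<Longrightarrow> P (\<Sum>k\<in>A. Poly_Mapping.single k (Poly_Mapping.lookup x k))" for A
    by (induction A rule: finite_induct) (simp_all add: zero assms)
  have "x = (\<Sum>k\<in>Poly_Mapping.keys x. Poly_Mapping.single k (Poly_Mapping.lookup x k))"
    by (rule poly_mapping_eqI) (simp add: lookup_sum lookup_single when_def in_keys_iff)
  then show ?thesis
    using sums[of "Poly_Mapping.keys x"] by simp
qed

text \<open>The linear functional with prescribed values on a basis. Operator-valued linear maps are
  treated entry by entry through such functionals.\<close>

definition lin_ext :: "('k \<Rightarrow> complex) \<Rightarrow> ('k \<Rightarrow>\<^sub>0 complex) \<Rightarrow> complex" where
  "lin_ext f t = (\<Sum>k\<in>Poly_Mapping.keys t. Poly_Mapping.lookup t k * f k)"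

text \<open>Cancellation can make the support of a sum smaller than the union of the supports;
  enlarging the index set lets several elements be summed over a common one.\<close>

lemma lin_ext_superset:
  assumes "finite A" "Poly_Mapping.keys t \<subseteq> A"
  shows "lin_ext f t = (\<Sum>k\<in>A. Poly_Mapping.lookup t k * f k)"
  unfolding lin_ext_def using assms by (intro sum.mono_neutral_left) (auto simp: in_keys_iff)

lemma lin_ext_zero [simp]: "lin_ext f 0 = 0"
  by (simp add: lin_ext_def)

lemma lin_ext_add: "lin_ext f (s + t) = lin_ext f s + lin_ext f t"
proof -
  let ?A = "Poly_Mapping.keys s \<union> Poly_Mapping.keys t"
  have "lin_ext f u = (\<Sum>k\<in>?A. Poly_Mapping.lookup u k * f k)" if "u \<in> {s, t, s + t}" for u
    using that keys_add[of s t] by (intro lin_ext_superset) auto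
  then show ?thesis
    by (simp add: lookup_add sum.distrib algebra_simps)
qed

lemma lin_ext_diff: "lin_ext f (s - t) = lin_ext f s - lin_ext f t"
  using lin_ext_add[of f "s - t" t] by simp

lemma lin_ext_sum: "lin_ext f (sum g A) = (\<Sum>a\<in>A. lin_ext f (g a))"
  by (induction A rule: infinite_finite_induct) (simp_all add: lin_ext_add)

lemma lin_ext_single [simp]: "lin_ext f (Poly_Mapping.single k c) = c * f k"
  by (simp add: lin_ext_def)

section \<open>Matrix representations of the free algebra\<close>

primrec rep_word :: "(gen \<Rightarrow> complex ^ 'n ^ 'n) \<Rightarrow> gen list \<Rightarrow> complex ^ 'n ^ 'n" where
  "rep_word h [] = mat 1"
| "rep_word h (g # w) = h g ** rep_word h w"

lemma rep_word_append: "rep_word h (v @ w) = rep_word h v ** rep_word h w"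
  by (induction v) (simp_all add: matrix_mul_assoc)

definition rep :: "(gen \<Rightarrow> complex ^ 'n ^ 'n) \<Rightarrow> free_alg \<Rightarrow> complex ^ 'n ^ 'n" where
  "rep h x = (\<chi> r c. lin_ext (\<lambda>w. rep_word h w $ r $ c) x)"

text \<open>Scalar multiples are written as products with scalar matrices \<open>mat k\<close>, so
  that scalars and operators are handled by one associative product.\<close>

lemma mat_matrix_mult_nth: "(mat k ** A) $ r $ c = k * A $ r $ c" for A :: "complex ^ 'm ^ 'n"
  by (simp add: matrix_matrix_mult_def mat_def if_distrib[of "\<lambda>x. x * _"] cong: if_cong)

lemma matrix_mult_mat_nth: "(A ** mat k) $ r $ c = A $ r $ c * k" for A :: "complex ^ 'm ^ 'n"
  by (simp add: matrix_matrix_mult_def mat_def if_distrib[of "\<lambda>x. _ * x"] cong: if_cong)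

lemma mat_matrix_mult_commute: "mat k ** A = A ** mat k" for A :: "complex ^ 'm ^ 'n"
  by (simp add: vec_eq_iff mat_matrix_mult_nth matrix_mult_mat_nth)

lemma matrix_mult_add_left: "(A + B) ** C = A ** C + B ** C" for C :: "complex ^ 'm ^ 'n"
  by (simp add: vec_eq_iff matrix_matrix_mult_def sum.distrib distrib_right)

lemma mat_mult_mat: "mat a ** mat b = (mat (a * b) :: complex ^ 'n ^ 'n)"
  by (simp add: vec_eq_iff mat_matrix_mult_nth) (simp add: mat_def)

lemma rep_add: "rep h (x + y) = rep h x + rep h y"
  by (simp add: rep_def lin_ext_add vec_eq_iff)

lemma rep_diff: "rep h (x - y) = rep h x - rep h y"
  by (simp add: rep_def lin_ext_diff vec_eq_iff)

lemma rep_zero [simp]: "rep h 0 = 0"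
  by (simp add: rep_def vec_eq_iff)

lemma rep_single: "rep h (Poly_Mapping.single w c) = mat c ** rep_word h w"
  by (simp add: rep_def vec_eq_iff mat_matrix_mult_nth)

lemma rep_scal: "rep h (scal c) = mat c"
  by (simp add: scal_def rep_single)

lemma rep_one [simp]: "rep h 1 = mat 1"
proof -
  have "(1 :: free_alg) = scal 1"
    by (simp add: scal_def single_one zero_list_def[symmetric])
  then show ?thesis by (metis rep_scal)
qed

lemma rep_gn: "rep h (gn g) = h g"
  by (simp add: gn_def rep_single)

text \<open>Both sides are additive in each argument, which leaves two single words: their product
  is concatenation, and scalar matrices move past everything.\<close>

lemma rep_mult: "rep h (x * y) = rep h x ** rep h y"
proof (induction x rule: poly_mapping_add_induct)
  case (single v a)
  show ?case
  proof (induction y rule: poly_mapping_add_induct)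
    case (single w b)
    have "mat (a * b) ** (rep_word h v ** rep_word h w) =
        mat a ** (mat b ** rep_word h v) ** rep_word h w"
      by (simp add: matrix_mul_assoc mat_mult_mat)
    also have "\<dots> = (mat a ** rep_word h v) ** (mat b ** rep_word h w)"
      by (simp add: mat_matrix_mult_commute[of b "rep_word h v"] matrix_mul_assoc)
    finally show ?case
      by (simp add: mult_single rep_single rep_word_append plus_list_def)
  next
    case (add x y)
    then show ?case by (simp add: rep_add distrib_left matrix_add_ldistrib)
  qed
next
  case (add x y)
  then show ?case by (simp add: rep_add distrib_right matrix_mult_add_left)
qed

definition matrix_qcomm :: "complex \<Rightarrow> complex ^ 'n ^ 'n \<Rightarrow> complex ^ 'n ^ 'n \<Rightarrow> complex ^ 'n ^ 'n"
  where "matrix_qcomm c A B = A ** B - mat c ** (B ** A)"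

definition matrix_serre :: "complex \<Rightarrow> complex ^ 'n ^ 'n \<Rightarrow> complex ^ 'n ^ 'n \<Rightarrow> complex ^ 'n ^ 'n"
  where "matrix_serre q A B =
    matrix_qcomm (- (q powi 2)) A (matrix_qcomm 1 A (matrix_qcomm (- (q powi (-2))) A B))"

lemma rep_qcomm: "rep h (qcomm c x y) = matrix_qcomm c (rep h x) (rep h y)"
  by (simp add: qcomm_def matrix_qcomm_def rep_diff rep_mult rep_scal)

lemma rep_serre: "rep h (serre q x y) = matrix_serre q (rep h x) (rep h y)"
  by (simp add: serre_def matrix_serre_def rep_qcomm)

section \<open>Descent of representations to the quotient by the relations\<close>

definition uq_rep :: "complex \<Rightarrow> (gen \<Rightarrow> complex ^ 'n ^ 'n) \<Rightarrow> bool" where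
  "uq_rep q h \<longleftrightarrow>
     (\<forall>i. h (K i) ** h (Kinv i) = mat 1 \<and> h (Kinv i) ** h (K i) = mat 1)
   \<and> (\<forall>i j. h (K i) ** h (K j) = h (K j) ** h (K i))
   \<and> (\<forall>i j. h (K i) ** h (E j) = mat (q powi cartan i j) ** (h (E j) ** h (K i)))
   \<and> (\<forall>i j. h (K i) ** h (F j) = mat (q powi (- cartan i j)) ** (h (F j) ** h (K i)))
   \<and> (\<forall>i j. h (E i) ** h (F j) + h (F j) ** h (E i)
        = (if i = j then mat (1 / (q + inverse q)) ** (h (K i) - h (Kinv i)) else 0))
   \<and> (\<forall>i j. i \<noteq> j \<longrightarrow> matrix_serre q (h (E i)) (h (E j)) = 0)
   \<and> (\<forall>i j. i \<noteq> j \<longrightarrow> matrix_serre q (h (F i)) (h (F j)) = 0)"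

lemma rep_uq_relations:
  assumes "uq_rep q h" "x \<in> uq_relations q"
  shows "rep h x = 0"
  using assms unfolding uq_rep_def uq_relations_def
  by (elim conjE UnE CollectE exE)
    (simp_all add: rep_diff rep_add rep_mult rep_gn rep_scal rep_serre)

lemma a_inv_free_ring: "\<ominus>\<^bsub>free_ring\<^esub> x = - x"
proof -
  interpret ring free_ring by (rule ring_free_ring)
  show ?thesis
    by (rule minus_equality) (simp_all add: free_ring_def)
qed

lemma ideal_rep_kernel: "ideal {x. rep h x = 0} free_ring"
proof (rule idealI[OF ring_free_ring])
  show "subgroup {x. rep h x = 0} (add_monoid free_ring)"
  proof
    fix x assume "x \<in> {x. rep h x = 0}"
    then show "inv\<^bsub>add_monoid free_ring\<^esub> x \<in> {x. rep h x = 0}"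
      using a_inv_free_ring[of x] rep_diff[of h 0 x] by (simp add: a_inv_def)
  qed (simp_all add: free_ring_def rep_add)
qed (simp_all add: free_ring_def rep_mult matrix_matrix_mult_def vec_eq_iff)

text \<open>The kernel of a representation is a two-sided ideal; once it contains the relations, it
  contains the ideal that they generate.\<close>

lemma rep_uq_ideal:
  assumes "uq_rep q h" "x \<in> uq_ideal q"
  shows "rep h x = 0"
  using ring.genideal_minimal[OF ring_free_ring ideal_rep_kernel, of "uq_relations q" h]
    rep_uq_relations[OF assms(1)] assms(2) unfolding uq_ideal_def by auto

lemma carrier_uq: "carrier (uq q) = range (\<lambda>x. (\<lambda>y. y + x) ` uq_ideal q)"
  by (auto simp: uq_def FactRing_def A_RCOSETS_def' a_r_coset_def' free_ring_def)

text \<open>Every coset thus contains the representative by which it is written, so that the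
  coproduct of a coset is nonempty.\<close>

lemma zero_in_uq_ideal: "0 \<in> uq_ideal q"
proof -
  interpret ring free_ring by (rule ring_free_ring)
  interpret ideal "uq_ideal q" free_ring
    unfolding uq_ideal_def by (rule genideal_ideal) (simp add: free_ring_def)
  show ?thesis using zero_closed by (simp add: free_ring_def)
qed

text \<open>Moving \<open>M\<close> through a word one letter at a time gives the claim for words;
  linearity gives the rest, since \<open>M\<close> commutes with scalar matrices.\<close>

lemma rep_intertwines:
  assumes "\<And>g. h' g ** M = M ** h g"
  shows "rep h' x ** M = M ** rep h x"
proof (induction x rule: poly_mapping_add_induct)
  case (single w c)
  have "rep_word h' w ** M = M ** rep_word h w"
  proof (induction w)
    case (Cons g w)
    have "rep_word h' (g # w) ** M = h' g ** (rep_word h' w ** M)"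
      by (simp add: matrix_mul_assoc)
    also have "\<dots> = (h' g ** M) ** rep_word h w"
      by (simp add: Cons.IH matrix_mul_assoc)
    also have "\<dots> = M ** rep_word h (g # w)"
      by (simp add: assms matrix_mul_assoc)
    finally show ?case .
  qed simp
  then have "mat c ** (rep_word h' w ** M) = (M ** mat c) ** rep_word h w"
    by (simp add: matrix_mul_assoc mat_matrix_mult_commute[of c M])
  then show ?case
    by (simp add: rep_single matrix_mul_assoc)
next
  case (add x y)
  then show ?case by (simp add: rep_add matrix_add_ldistrib matrix_mult_add_left)
qed

section \<open>The action of the tensor square\<close>

lemma super_sign_zero [simp]: "super_sign 0 b = 1" "super_sign b 0 = 1"
  by (simp_all add: super_sign_def)

lemma super_sign_add: "super_sign (a + b) c = super_sign a c * super_sign b c"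
  by (cases a; cases b) (simp_all add: super_sign_def)

lemma super_sign_add_right: "super_sign a (b + c) = super_sign a b * super_sign a c"
  by (cases b; cases c) (simp_all add: super_sign_def)

lemma super_sign_square: "super_sign a b * super_sign a b = 1"
  by (simp add: super_sign_def)

lemma word_parity_Nil [simp]: "word_parity [] = 0"
  by (simp add: word_parity_def)

lemma word_parity_Cons [simp]: "word_parity (g # w) = gen_parity g + word_parity w"
  by (simp add: word_parity_def)

lemma word_parity_append [simp]: "word_parity (v @ w) = word_parity v + word_parity w"
  by (simp add: word_parity_def)

lemma bvec_nth: "bvec j $ r = (if r = j then 1 else 0)"
  by (simp add: bvec_def axis_def)

lemma ev_word_eq_rep_word: "ev_word q l e = rep_word (ev_gen q l e)"
proof
  show "ev_word q l e w = rep_word (ev_gen q l e) w" for w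
    by (induction w) simp_all
qed

text \<open>The two basis vectors have opposite parities because their signs are \<open>e\<close>
  and \<open>- e\<close>. The odd generators send each of them to a multiple of the other, and the
  even ones act diagonally.\<close>

lemma v_parity_ev_gen:
  assumes "e \<in> {1, -1}" "ev_gen q l e g $ r $ c \<noteq> 0"
  shows "v_parity e r = gen_parity g + v_parity e c"
  using assms
  by (cases g; cases r; cases c) (auto simp: ev_gen_def bvec_nth v_parity_def Let_def split: if_splits)

lemma v_parity_ev_word:
  assumes "e \<in> {1, -1}" "ev_word q l e w $ r $ c \<noteq> 0"
  shows "v_parity e r = word_parity w + v_parity e c"
  using assms(2)
proof (induction w arbitrary: r)
  case Nil
  then show ?case by (simp add: mat_def split: if_splits)
next
  case (Cons g w)
  from Cons.prems have "(\<Sum>k\<in>UNIV. ev_gen q l e g $ r $ k * ev_word q l e w $ k $ c) \<noteq> 0"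
    by (simp add: matrix_matrix_mult_def)
  \<comment> \<open>A nonzero entry of the product has a nonzero path through some basis vector
    \<open>k\<close>, and parities add along this path.\<close>
  then obtain k where "ev_gen q l e g $ r $ k \<noteq> 0" "ev_word q l e w $ k $ c \<noteq> 0"
    by (metis (mono_tags, lifting) mult_eq_0_iff sum.neutral)
  then show ?case
    using v_parity_ev_gen[OF assms(1)] Cons.IH by (simp add: add.assoc)
qed

section \<open>The super product as composition of operators\<close>

definition tensor_word ::
  "complex \<Rightarrow> complex \<Rightarrow> complex \<Rightarrow> complex \<Rightarrow> complex \<Rightarrow> gen list \<times> gen list
     \<Rightarrow> complex ^ (bit \<times> bit) ^ (bit \<times> bit)" where
  "tensor_word q l1 e1 l2 e2 p =
     super_tensor e1 (word_parity (snd p)) (ev_word q l1 e1 (fst p)) (ev_word q l2 e2 (snd p))"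

lemma tensor_word_nth:
  "tensor_word q l1 e1 l2 e2 (a, b) $ r $ c =
     super_sign (word_parity b) (v_parity e1 (fst c))
       * ev_word q l1 e1 a $ fst r $ fst c * ev_word q l2 e2 b $ snd r $ snd c"
  by (simp add: tensor_word_def super_tensor_def)

lemma tensor_action_free_nth:
  "tensor_action_free q l1 e1 l2 e2 t $ r $ c = lin_ext (\<lambda>p. tensor_word q l1 e1 l2 e2 p $ r $ c) t"
  by (simp add: tensor_action_free_def lin_ext_def tensor_word_def case_prod_unfold)

lemma tensor_action_free_add:
  "tensor_action_free q l1 e1 l2 e2 (s + t) =
     tensor_action_free q l1 e1 l2 e2 s + tensor_action_free q l1 e1 l2 e2 t"
  by (simp add: vec_eq_iff tensor_action_free_nth lin_ext_add)

lemma tensor_action_free_diff: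
  "tensor_action_free q l1 e1 l2 e2 (s - t) =
     tensor_action_free q l1 e1 l2 e2 s - tensor_action_free q l1 e1 l2 e2 t"
  by (simp add: vec_eq_iff tensor_action_free_nth lin_ext_diff)

lemma tensor_action_free_single:
  "tensor_action_free q l1 e1 l2 e2 (Poly_Mapping.single p 1) = tensor_word q l1 e1 l2 e2 p"
  by (simp add: vec_eq_iff tensor_action_free_nth)

lemma lin_ext_tscale: "lin_ext f (tscale k t) = k * lin_ext f t"
proof -
  have "lin_ext f (tscale k t) =
      (\<Sum>p\<in>Poly_Mapping.keys t. Poly_Mapping.lookup (tscale k t) p * f p)"
    by (rule lin_ext_superset) (auto simp: in_keys_iff lookup_tscale)
  then show ?thesis
    by (simp add: lookup_tscale lin_ext_def sum_distrib_left mult.assoc)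
qed

lemma sum_fst_snd:
  fixes f :: "'a::finite \<Rightarrow> complex" and g :: "'b::finite \<Rightarrow> complex"
  shows "(\<Sum>p\<in>UNIV. f (fst p) * g (snd p)) = (\<Sum>a\<in>UNIV. f a) * (\<Sum>b\<in>UNIV. g b)"
  by (simp only: sum_product sum.cartesian_product UNIV_Times_UNIV case_prod_unfold)

text \<open>In the composite, \<open>b\<close> passes a vector of the first factor that
  \<open>c\<close> has already moved, so its parity has changed by that of \<open>c\<close>; this is
  the sign of the super product. The sum over pairs then splits into two matrix products.\<close>

lemma tensor_word_append:
  assumes "e1 \<in> {1, -1}"
  shows "super_sign (word_parity b) (word_parity c) * tensor_word q l1 e1 l2 e2 (a @ c, b @ d) $ i $ j
     = (tensor_word q l1 e1 l2 e2 (a, b) ** tensor_word q l1 e1 l2 e2 (c, d)) $ i $ j"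
proof -
  let ?A = "ev_word q l1 e1" and ?B = "ev_word q l2 e2" and ?v = "v_parity e1"
  let ?s = "super_sign (word_parity b) (word_parity c)
    * super_sign (word_parity b + word_parity d) (?v (fst j))"
  \<comment> \<open>If the entry of \<open>c\<close> vanishes, so do both sides; otherwise
    homogeneity determines the parity of \<open>k\<close>.\<close>
  have shift: "super_sign (word_parity b) (?v k) * ?A c $ k $ fst j
      = super_sign (word_parity b) (word_parity c) * super_sign (word_parity b) (?v (fst j))
          * ?A c $ k $ fst j" for k
    using v_parity_ev_word[OF assms, of q l1 c k "fst j"]
    by (cases "?A c $ k $ fst j = 0") (simp_all add: super_sign_add_right)
  have "(tensor_word q l1 e1 l2 e2 (a, b) ** tensor_word q l1 e1 l2 e2 (c, d)) $ i $ j
      = (\<Sum>p\<in>UNIV. (super_sign (word_parity b) (?v (fst p)) * ?A c $ fst p $ fst j)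
          * ?A a $ fst i $ fst p * ?B b $ snd i $ snd p
          * super_sign (word_parity d) (?v (fst j)) * ?B d $ snd p $ snd j)"
    by (simp add: matrix_matrix_mult_def tensor_word_nth mult_ac)
  also have "\<dots> = (\<Sum>p\<in>UNIV. ?s * ((?A a $ fst i $ fst p * ?A c $ fst p $ fst j)
          * (?B b $ snd i $ snd p * ?B d $ snd p $ snd j)))"
    unfolding shift super_sign_add by (simp add: mult_ac)
  also have "\<dots> = ?s * ((\<Sum>k\<in>UNIV. ?A a $ fst i $ k * ?A c $ k $ fst j)
          * (\<Sum>m\<in>UNIV. ?B b $ snd i $ m * ?B d $ m $ snd j))"
    by (simp only: sum_distrib_left[symmetric]
        sum_fst_snd[of "\<lambda>k. ?A a $ fst i $ k * ?A c $ k $ fst j" "\<lambda>m. ?B b $ snd i $ m * ?B d $ m $ snd j"])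
  also have "\<dots> = super_sign (word_parity b) (word_parity c)
      * tensor_word q l1 e1 l2 e2 (a @ c, b @ d) $ i $ j"
    unfolding tensor_word_nth ev_word_eq_rep_word rep_word_append
    by (simp add: matrix_matrix_mult_def)
  finally show ?thesis ..
qed

lemma tensor_action_free_tmult:
  assumes "e1 \<in> {1, -1}"
  shows "tensor_action_free q l1 e1 l2 e2 (tmult s t) =
     tensor_action_free q l1 e1 l2 e2 s ** tensor_action_free q l1 e1 l2 e2 t"
proof -
  let ?T = "tensor_word q l1 e1 l2 e2"
  have "tensor_action_free q l1 e1 l2 e2 (tmult s t) $ i $ j =
     (tensor_action_free q l1 e1 l2 e2 s ** tensor_action_free q l1 e1 l2 e2 t) $ i $ j" for i j
  proof -
    have "tensor_action_free q l1 e1 l2 e2 (tmult s t) $ i $ j =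
      (\<Sum>p\<in>Poly_Mapping.keys s. \<Sum>p'\<in>Poly_Mapping.keys t. Poly_Mapping.lookup s p * Poly_Mapping.lookup t p'
         * (super_sign (word_parity (snd p)) (word_parity (fst p'))
              * ?T (fst p @ fst p', snd p @ snd p') $ i $ j))"
      by (simp add: tensor_action_free_nth tmult_def lin_ext_sum case_prod_unfold mult_ac)
    also have "\<dots> = (\<Sum>p\<in>Poly_Mapping.keys s. \<Sum>p'\<in>Poly_Mapping.keys t. \<Sum>k\<in>UNIV.
        (Poly_Mapping.lookup s p * ?T p $ i $ k) * (Poly_Mapping.lookup t p' * ?T p' $ k $ j))"
      unfolding tensor_word_append[OF assms]
      by (simp add: matrix_matrix_mult_def sum_distrib_left mult_ac)
    \<comment> \<open>The sum over the intermediate basis vector is brought outermost, where the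
      double sum over the supports factorises.\<close>
    also have "\<dots> = (\<Sum>p\<in>Poly_Mapping.keys s. \<Sum>k\<in>UNIV. \<Sum>p'\<in>Poly_Mapping.keys t.
        (Poly_Mapping.lookup s p * ?T p $ i $ k) * (Poly_Mapping.lookup t p' * ?T p' $ k $ j))"
      by (rule sum.cong[OF refl]) (rule sum.swap)
    also have "\<dots> = (\<Sum>k\<in>UNIV. \<Sum>p\<in>Poly_Mapping.keys s. \<Sum>p'\<in>Poly_Mapping.keys t.
        (Poly_Mapping.lookup s p * ?T p $ i $ k) * (Poly_Mapping.lookup t p' * ?T p' $ k $ j))"
      by (rule sum.swap)
    also have "\<dots> = (tensor_action_free q l1 e1 l2 e2 s ** tensor_action_free q l1 e1 l2 e2 t) $ i $ j"
      by (simp add: matrix_matrix_mult_def tensor_action_free_nth lin_ext_def sum_product)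
    finally show ?thesis .
  qed
  then show ?thesis by (simp add: vec_eq_iff)
qed

text \<open>As \<open>y\<close> may be inhomogeneous, the sign varies with its words. A nonzero
  entry, however, forces the parity of the word to be the difference of the parities of row and
  column, so the sign comes out of the sum and the entry factorises.\<close>

lemma tensor_action_free_tens:
  assumes "e2 \<in> {1, -1}"
  shows "tensor_action_free q l1 e1 l2 e2 (tens x y) $ r $ c =
     rep (ev_gen q l1 e1) x $ fst r $ fst c
     * (super_sign (v_parity e2 (snd c) + v_parity e2 (snd r)) (v_parity e1 (fst c))
        * rep (ev_gen q l2 e2) y $ snd r $ snd c)"
proof -
  have sign: "super_sign (word_parity b) (v_parity e1 (fst c)) * ev_word q l2 e2 b $ snd r $ snd c
     = super_sign (v_parity e2 (snd c) + v_parity e2 (snd r)) (v_parity e1 (fst c))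
        * ev_word q l2 e2 b $ snd r $ snd c" for b
    using v_parity_ev_word[OF assms, of q l2 b "snd r" "snd c"]
    by (cases "ev_word q l2 e2 b $ snd r $ snd c = 0") (simp_all add: add_ac)
  have "tensor_action_free q l1 e1 l2 e2 (tens x y) $ r $ c =
     (\<Sum>a\<in>Poly_Mapping.keys x. \<Sum>b\<in>Poly_Mapping.keys y.
        (Poly_Mapping.lookup x a * ev_word q l1 e1 a $ fst r $ fst c)
        * (Poly_Mapping.lookup y b * (super_sign (word_parity b) (v_parity e1 (fst c))
              * ev_word q l2 e2 b $ snd r $ snd c)))"
    by (simp add: tensor_action_free_nth tens_def lin_ext_sum tensor_word_nth mult_ac)
  also have "\<dots> = (\<Sum>a\<in>Poly_Mapping.keys x. Poly_Mapping.lookup x a * ev_word q l1 e1 a $ fst r $ fst c)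
      * (\<Sum>b\<in>Poly_Mapping.keys y. Poly_Mapping.lookup y b
          * (super_sign (v_parity e2 (snd c) + v_parity e2 (snd r)) (v_parity e1 (fst c))
              * ev_word q l2 e2 b $ snd r $ snd c))"
    unfolding sign by (rule sum_product[symmetric])
  also have "(\<Sum>b\<in>Poly_Mapping.keys y. Poly_Mapping.lookup y b
          * (super_sign (v_parity e2 (snd c) + v_parity e2 (snd r)) (v_parity e1 (fst c))
              * ev_word q l2 e2 b $ snd r $ snd c))
      = super_sign (v_parity e2 (snd c) + v_parity e2 (snd r)) (v_parity e1 (fst c))
          * rep (ev_gen q l2 e2) y $ snd r $ snd c"
    by (simp add: rep_def lin_ext_def ev_word_eq_rep_word sum_distrib_left mult_ac)
  finally show ?thesis
    by (simp add: rep_def lin_ext_def ev_word_eq_rep_word)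
qed

text \<open>By the factorised form of the entries, a pure tensor with one factor in
  \<open>uq_ideal q\<close> acts as 0. The elements acting as 0 form a subspace, which therefore
  contains the span.\<close>

lemma tensor_action_free_tensor_ideal:
  assumes "e2 \<in> {1, -1}" "uq_rep q (ev_gen q l1 e1)" "uq_rep q (ev_gen q l2 e2)"
    and "t \<in> tensor_ideal q"
  shows "tensor_action_free q l1 e1 l2 e2 t = 0"
proof -
  interpret T: module tscale by (rule module_tscale)
  have "T.subspace {t. tensor_action_free q l1 e1 l2 e2 t = 0}"
    by (simp add: T.subspace_def tensor_action_free_add vec_eq_iff tensor_action_free_nth
        lin_ext_add lin_ext_tscale)
  moreover have "{tens x y | x y. x \<in> uq_ideal q \<or> y \<in> uq_ideal q}
      \<subseteq> {t. tensor_action_free q l1 e1 l2 e2 t = 0}"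
    using assms(1-3) by (auto simp: vec_eq_iff tensor_action_free_tens rep_uq_ideal)
  ultimately show ?thesis
    using T.span_minimal assms(4) unfolding tensor_ideal_def by blast
qed

section \<open>Coproduct and opposite coproduct as operators on the tensor product\<close>

definition tensor_gen ::
  "complex \<Rightarrow> complex \<Rightarrow> complex \<Rightarrow> complex \<Rightarrow> complex \<Rightarrow> gen
     \<Rightarrow> complex ^ (bit \<times> bit) ^ (bit \<times> bit)" where
  "tensor_gen q l1 e1 l2 e2 g = tensor_action_free q l1 e1 l2 e2 (coprod_gen g)"

lemma one_free_alg: "(1 :: free_alg) = Poly_Mapping.single [] 1"
  by (metis single_one zero_list_def)

lemma tens_single:
  "tens (Poly_Mapping.single a x) (Poly_Mapping.single b y) = Poly_Mapping.single (a, b) (x * y)"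
  by (simp add: tens_def)

lemma tensor_word_Nil: "tensor_word q l1 e1 l2 e2 ([], []) = mat 1"
  by (auto simp: vec_eq_iff tensor_word_nth mat_def)

lemma tensor_action_coprod_word:
  assumes "e1 \<in> {1, -1}"
  shows "tensor_action_free q l1 e1 l2 e2 (coprod_word w) = rep_word (tensor_gen q l1 e1 l2 e2) w"
  by (induction w)
    (simp_all add: tensor_gen_def tensor_action_free_tmult[OF assms] one_free_alg tens_single
      tensor_action_free_single tensor_word_Nil)

lemma tensor_action_coprod_free:
  assumes "e1 \<in> {1, -1}"
  shows "tensor_action_free q l1 e1 l2 e2 (coprod_free x) = rep (tensor_gen q l1 e1 l2 e2) x"
  unfolding vec_eq_iff tensor_action_free_nth coprod_free_def lin_ext_sum lin_ext_tscale
  by (simp add: rep_def lin_ext_def[of _ x] tensor_action_coprod_word[OF assms, symmetric]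
      tensor_action_free_nth)

text \<open>Two ambiguities disappear: elements of \<open>tensor_ideal q\<close> act as 0, and
  elements of \<open>uq_ideal q\<close> contribute 0 because the matrices \<open>tensor_gen\<close>
  satisfy the relations. The image is a singleton, as \<open>the_elem\<close> requires.\<close>

lemma tensor_action_free_coproduct:
  assumes "e1 \<in> {1, -1}" "e2 \<in> {1, -1}"
    and "uq_rep q (ev_gen q l1 e1)" "uq_rep q (ev_gen q l2 e2)"
    and "uq_rep q (tensor_gen q l1 e1 l2 e2)"
  shows "tensor_action_free q l1 e1 l2 e2 ` coproduct q ((\<lambda>y. y + x) ` uq_ideal q)
    = {rep (tensor_gen q l1 e1 l2 e2) x}"
proof -
  interpret T: module tscale by (rule module_tscale)
  have "0 \<in> tensor_ideal q"
    unfolding tensor_ideal_def by (rule T.span_zero)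
  then have "coprod_free (0 + x) \<in> coproduct q ((\<lambda>y. y + x) ` uq_ideal q)"
    using zero_in_uq_ideal[of q] unfolding coproduct_def tensor_coset_def by fastforce
  then have "coproduct q ((\<lambda>y. y + x) ` uq_ideal q) \<noteq> {}"
    by blast
  moreover have "tensor_action_free q l1 e1 l2 e2 t = rep (tensor_gen q l1 e1 l2 e2) x"
    if "t \<in> coproduct q ((\<lambda>y. y + x) ` uq_ideal q)" for t
  proof -
    from that obtain y where y: "y \<in> uq_ideal q" "t - coprod_free (y + x) \<in> tensor_ideal q"
      by (auto simp: coproduct_def tensor_coset_def)
    then have "tensor_action_free q l1 e1 l2 e2 t = rep (tensor_gen q l1 e1 l2 e2) (y + x)"
      using tensor_action_free_tensor_ideal[OF assms(2-4) y(2)] assms(1)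
      by (simp add: tensor_action_free_diff tensor_action_coprod_free)
    then show ?thesis
      using rep_uq_ideal[OF assms(5) y(1)] by (simp add: rep_add)
  qed
  ultimately show ?thesis by (simp add: image_constant_conv cong: image_cong)
qed

text \<open>Conjugation by the super flip: \<open>A\<close> acts on the tensor product in the
  opposite order, with signs \<open>e2\<close>, \<open>e1\<close>, and is carried to the order
  \<open>e1\<close>, \<open>e2\<close>. The flip signs are their own inverses, so row and column
  contribute them alike.\<close>

definition flip_conj :: "complex \<Rightarrow> complex \<Rightarrow> complex ^ (bit \<times> bit) ^ (bit \<times> bit)
    \<Rightarrow> complex ^ (bit \<times> bit) ^ (bit \<times> bit)" where
  "flip_conj e1 e2 A = (\<chi> r c.
     super_sign (v_parity e1 (fst r)) (v_parity e2 (snd r))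
     * super_sign (v_parity e1 (fst c)) (v_parity e2 (snd c)) * A $ prod.swap r $ prod.swap c)"

lemma lin_ext_cmult: "lin_ext (\<lambda>p. k * f p) t = k * lin_ext f t"
  by (simp add: lin_ext_def sum_distrib_left mult_ac)

lemma flip_conj_mult: "flip_conj e1 e2 (A ** B) = flip_conj e1 e2 A ** flip_conj e1 e2 B"
proof -
  let ?s = "\<lambda>p. super_sign (v_parity e1 (fst p)) (v_parity e2 (snd p))"
  have "flip_conj e1 e2 (A ** B) $ r $ c = (flip_conj e1 e2 A ** flip_conj e1 e2 B) $ r $ c" for r c
  proof -
    have "flip_conj e1 e2 (A ** B) $ r $ c =
        (\<Sum>k\<in>UNIV. ?s r * ?s c * (A $ prod.swap r $ prod.swap k * B $ prod.swap k $ prod.swap c))"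
      using sum.reindex_bij_betw[OF bij_swap, of "\<lambda>k. A $ prod.swap r $ k * B $ k $ prod.swap c"]
      unfolding flip_conj_def matrix_matrix_mult_def sum_distrib_left[symmetric] by simp
    also have "\<dots> = (\<Sum>k\<in>UNIV. (?s k * ?s k) * (?s r * A $ prod.swap r $ prod.swap k
        * ?s c * B $ prod.swap k $ prod.swap c))"
      unfolding super_sign_square by (simp add: mult_ac)
    finally show ?thesis
      by (simp add: flip_conj_def matrix_matrix_mult_def mult_ac)
  qed
  then show ?thesis by (simp add: vec_eq_iff)
qed

lemma flip_conj_one: "flip_conj e1 e2 (mat 1) = mat 1"
  by (auto simp: vec_eq_iff flip_conj_def mat_def super_sign_square prod.swap_def prod_eq_iff)

lemma flip_conj_rep_word: "flip_conj e1 e2 (rep_word h w) = rep_word (\<lambda>g. flip_conj e1 e2 (h g)) w"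
  by (induction w) (simp_all add: flip_conj_mult flip_conj_one)

lemma flip_conj_rep: "flip_conj e1 e2 (rep h x) = rep (\<lambda>g. flip_conj e1 e2 (h g)) x"
  unfolding rep_def flip_conj_rep_word[symmetric]
  by (simp add: vec_eq_iff flip_conj_def lin_ext_cmult)

text \<open>If one of the two word entries vanishes, both sides are 0. Otherwise homogeneity
  expresses the row parities by those of the columns and the words, and the signs agree in all
  sixteen cases for these four parities.\<close>

lemma tensor_action_super_flip:
  assumes "e1 \<in> {1, -1}" "e2 \<in> {1, -1}"
  shows "tensor_action_free q l1 e1 l2 e2 (super_flip t) =
    flip_conj e1 e2 (tensor_action_free q l2 e2 l1 e1 t)"
proof -
  have word: "super_sign (word_parity a) (word_parity b) * tensor_word q l1 e1 l2 e2 (b, a) $ r $ c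
    = flip_conj e1 e2 (tensor_word q l2 e2 l1 e1 (a, b)) $ r $ c" for a b r c
  proof (cases "ev_word q l1 e1 b $ fst r $ fst c = 0 \<or> ev_word q l2 e2 a $ snd r $ snd c = 0")
    case False
    then have "v_parity e1 (fst r) = word_parity b + v_parity e1 (fst c)"
      and "v_parity e2 (snd r) = word_parity a + v_parity e2 (snd c)"
      using v_parity_ev_word assms by blast+
    then show ?thesis
      by (cases "word_parity a"; cases "word_parity b"; cases "v_parity e1 (fst c)";
          cases "v_parity e2 (snd c)")
        (simp_all add: flip_conj_def tensor_word_nth super_sign_def)
  qed (auto simp: flip_conj_def tensor_word_nth)
  have "tensor_action_free q l1 e1 l2 e2 (super_flip t) $ r $ c =
    flip_conj e1 e2 (tensor_action_free q l2 e2 l1 e1 t) $ r $ c" for r c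
  proof -
    have "tensor_action_free q l1 e1 l2 e2 (super_flip t) $ r $ c
      = (\<Sum>p\<in>Poly_Mapping.keys t. Poly_Mapping.lookup t p
          * (super_sign (word_parity (fst p)) (word_parity (snd p))
              * tensor_word q l1 e1 l2 e2 (snd p, fst p) $ r $ c))"
      by (simp add: tensor_action_free_nth super_flip_def lin_ext_sum case_prod_unfold mult_ac)
    also have "\<dots> = flip_conj e1 e2 (tensor_action_free q l2 e2 l1 e1 t) $ r $ c"
      unfolding word by (simp add: flip_conj_def tensor_action_free_nth lin_ext_def
          sum_distrib_left mult_ac)
    finally show ?thesis .
  qed
  then show ?thesis by (simp add: vec_eq_iff)
qed

text \<open>Reduction to finitely many matrix equations: a coset acts through any representative, a
  linear map is given by a matrix, and intertwining the generators suffices by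
  \<open>rep_intertwines\<close>.\<close>

lemma is_R_matrix_iff:
  assumes e: "e1 \<in> {1, -1}" "e2 \<in> {1, -1}"
    and ev: "uq_rep q (ev_gen q l1 e1)" "uq_rep q (ev_gen q l2 e2)"
    and tens: "uq_rep q (tensor_gen q l1 e1 l2 e2)" "uq_rep q (tensor_gen q l2 e2 l1 e1)"
  shows "is_R_matrix q l1 e1 l2 e2 R \<longleftrightarrow>
    (\<exists>M. R = (*v) M \<and> M \<noteq> 0
      \<and> (\<forall>g. flip_conj e1 e2 (tensor_gen q l2 e2 l1 e1 g) ** M = M ** tensor_gen q l1 e1 l2 e2 g))"
proof -
  let ?H = "tensor_gen q l1 e1 l2 e2" and ?H' = "\<lambda>g. flip_conj e1 e2 (tensor_gen q l2 e2 l1 e1 g)"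
  have action: "tensor_action q l1 e1 l2 e2 (coproduct q ((\<lambda>y. y + x) ` uq_ideal q)) = rep ?H x" for x
    unfolding tensor_action_def using tensor_action_free_coproduct[OF e ev tens(1)] by simp
  have "tensor_action_free q l1 e1 l2 e2 ` coproduct_op q X =
      flip_conj e1 e2 ` (tensor_action_free q l2 e2 l1 e1 ` coproduct q X)" for X
    unfolding coproduct_op_def image_image tensor_action_super_flip[OF e] ..
  then have action_op:
    "tensor_action q l1 e1 l2 e2 (coproduct_op q ((\<lambda>y. y + x) ` uq_ideal q)) = rep ?H' x" for x
    unfolding tensor_action_def
    using tensor_action_free_coproduct[OF e(2,1) ev(2,1) tens(2)] by (simp add: flip_conj_rep)
  have M: "(\<forall>x u. rep ?H' x *v (M *v u) = M *v (rep ?H x *v u)) \<longleftrightarrow> (\<forall>g. ?H' g ** M = M ** ?H g)" for M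
  proof
    assume "\<forall>x u. rep ?H' x *v (M *v u) = M *v (rep ?H x *v u)"
    then have "rep ?H' x ** M = M ** rep ?H x" for x
      by (simp add: matrix_eq matrix_vector_mul_assoc)
    then show "\<forall>g. ?H' g ** M = M ** ?H g"
      by (metis rep_gn)
  next
    assume "\<forall>g. ?H' g ** M = M ** ?H g"
    then show "\<forall>x u. rep ?H' x *v (M *v u) = M *v (rep ?H x *v u)"
      by (metis rep_intertwines matrix_vector_mul_assoc)
  qed
  have nonzero: "(*v) M \<noteq> (\<lambda>_. 0) \<longleftrightarrow> M \<noteq> 0" for M :: "complex ^ (bit \<times> bit) ^ (bit \<times> bit)"
    using matrix_eq[of M 0] by (auto simp: fun_eq_iff)
  have linear: "Vector_Spaces.linear (*s) (*s) R \<longleftrightarrow> (\<exists>M. R = (*v) M)"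
    using matrix_works[of R] by (metis ext matrix_vector_mul_linear_gen)
  show ?thesis
    unfolding is_R_matrix_def carrier_uq linear
    using M nonzero by (auto simp: action action_op)
qed

section \<open>Explicit matrices\<close>

lemma all_bit: "(\<forall>i::bit. P i) \<longleftrightarrow> P 0 \<and> P 1"
  by (metis bit.exhaust)

lemma sum_bit: "(\<Sum>i\<in>(UNIV :: bit set). f i) = f 0 + f 1"
  by (simp add: UNIV_bit)

lemma sum_bit_pair:
  "(\<Sum>p\<in>(UNIV :: (bit \<times> bit) set). f p) = f (0, 0) + f (0, 1) + f (1, 0) + f (1, 1)"
  using sum.cartesian_product[of "\<lambda>i j. f (i, j)" "UNIV :: bit set" "UNIV :: bit set", symmetric]
  by (simp add: sum_bit add.assoc)

lemma mat_nth: "mat k $ r $ c = (if r = c then k else 0)"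
  by (simp add: mat_def)

section \<open>Arithmetic of matrices given by their four rows\<close>

lemmas mat_of_rows4_expand =
  vec_eq_iff mat_of_rows4_def basis_pos_def split_paired_All all_bit

lemma mat_of_rows4_eq_iff:
  "mat_of_rows4 [[a1, a2, a3, a4], [a5, a6, a7, a8], [a9, a10, a11, a12], [a13, a14, a15, a16]]
   = mat_of_rows4 [[b1, b2, b3, b4], [b5, b6, b7, b8], [b9, b10, b11, b12], [b13, b14, b15, b16]]
   \<longleftrightarrow> a1 = b1 \<and> a2 = b2 \<and> a3 = b3 \<and> a4 = b4 \<and> a5 = b5 \<and> a6 = b6 \<and> a7 = b7 \<and> a8 = b8
     \<and> a9 = b9 \<and> a10 = b10 \<and> a11 = b11 \<and> a12 = b12 \<and> a13 = b13 \<and> a14 = b14 \<and> a15 = b15 \<and> a16 = b16"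
  by (simp add: mat_of_rows4_expand numeral_eq_Suc conj_ac)

lemma mat_of_rows4_add:
  "mat_of_rows4 [[a1, a2, a3, a4], [a5, a6, a7, a8], [a9, a10, a11, a12], [a13, a14, a15, a16]]
   + mat_of_rows4 [[b1, b2, b3, b4], [b5, b6, b7, b8], [b9, b10, b11, b12], [b13, b14, b15, b16]]
   = mat_of_rows4 [[a1 + b1, a2 + b2, a3 + b3, a4 + b4], [a5 + b5, a6 + b6, a7 + b7, a8 + b8],
      [a9 + b9, a10 + b10, a11 + b11, a12 + b12], [a13 + b13, a14 + b14, a15 + b15, a16 + b16]]"
  by (simp add: mat_of_rows4_expand numeral_eq_Suc)

lemma mat_of_rows4_diff:
  "mat_of_rows4 [[a1, a2, a3, a4], [a5, a6, a7, a8], [a9, a10, a11, a12], [a13, a14, a15, a16]]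
   - mat_of_rows4 [[b1, b2, b3, b4], [b5, b6, b7, b8], [b9, b10, b11, b12], [b13, b14, b15, b16]]
   = mat_of_rows4 [[a1 - b1, a2 - b2, a3 - b3, a4 - b4], [a5 - b5, a6 - b6, a7 - b7, a8 - b8],
      [a9 - b9, a10 - b10, a11 - b11, a12 - b12], [a13 - b13, a14 - b14, a15 - b15, a16 - b16]]"
  by (simp add: mat_of_rows4_expand numeral_eq_Suc)

lemma mat_of_rows4_mat:
  "mat k = mat_of_rows4 [[k, 0, 0, 0], [0, k, 0, 0], [0, 0, k, 0], [0, 0, 0, k]]"
  by (simp add: mat_of_rows4_expand mat_def numeral_eq_Suc)

lemma mat_of_rows4_zero:
  "0 = mat_of_rows4 [[0, 0, 0, 0], [0, 0, 0, 0], [0, 0, 0, 0], [0, 0, 0, 0]]"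
  by (simp add: mat_of_rows4_expand numeral_eq_Suc)

lemma mat_of_rows4_mult:
  "mat_of_rows4 [[a1, a2, a3, a4], [a5, a6, a7, a8], [a9, a10, a11, a12], [a13, a14, a15, a16]]
   ** mat_of_rows4 [[b1, b2, b3, b4], [b5, b6, b7, b8], [b9, b10, b11, b12], [b13, b14, b15, b16]]
   = mat_of_rows4
     [[a1 * b1 + a2 * b5 + a3 * b9 + a4 * b13, a1 * b2 + a2 * b6 + a3 * b10 + a4 * b14,
       a1 * b3 + a2 * b7 + a3 * b11 + a4 * b15, a1 * b4 + a2 * b8 + a3 * b12 + a4 * b16],
      [a5 * b1 + a6 * b5 + a7 * b9 + a8 * b13, a5 * b2 + a6 * b6 + a7 * b10 + a8 * b14,
       a5 * b3 + a6 * b7 + a7 * b11 + a8 * b15, a5 * b4 + a6 * b8 + a7 * b12 + a8 * b16],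
      [a9 * b1 + a10 * b5 + a11 * b9 + a12 * b13, a9 * b2 + a10 * b6 + a11 * b10 + a12 * b14,
       a9 * b3 + a10 * b7 + a11 * b11 + a12 * b15, a9 * b4 + a10 * b8 + a11 * b12 + a12 * b16],
      [a13 * b1 + a14 * b5 + a15 * b9 + a16 * b13, a13 * b2 + a14 * b6 + a15 * b10 + a16 * b14,
       a13 * b3 + a14 * b7 + a15 * b11 + a16 * b15, a13 * b4 + a14 * b8 + a15 * b12 + a16 * b16]]"
  by (simp add: mat_of_rows4_expand numeral_eq_Suc matrix_matrix_mult_def sum_bit_pair)

text \<open>The flip exchanges the second and third basis vectors. Exactly one basis vector has both
  factors odd, so exactly one flip sign is -1, and the product of two distinct flip signs is
  \<open>e1\<close>, \<open>e2\<close> or a signed variant.\<close>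

lemma flip_conj_mat_of_rows4:
  assumes "e1 \<in> {1, -1}" "e2 \<in> {1, -1}"
  shows "flip_conj e1 e2 (mat_of_rows4
      [[a1, a2, a3, a4], [a5, a6, a7, a8], [a9, a10, a11, a12], [a13, a14, a15, a16]])
   = mat_of_rows4 [[a1, e1 * a3, e2 * a2, - e1 * e2 * a4],
      [e1 * a9, a11, e1 * e2 * a10, - e2 * a12], [e2 * a5, e1 * e2 * a7, a6, - e1 * a8],
      [- e1 * e2 * a13, - e2 * a15, - e1 * a14, a16]]"
  using assms
  by (auto simp: mat_of_rows4_expand numeral_eq_Suc flip_conj_def v_parity_def super_sign_def)

lemma mat_of_rows4_cases:
  fixes M :: "complex ^ (bit \<times> bit) ^ (bit \<times> bit)"
  obtains a1 a2 a3 a4 a5 a6 a7 a8 a9 a10 a11 a12 a13 a14 a15 a16 where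
    "M = mat_of_rows4 [[a1, a2, a3, a4], [a5, a6, a7, a8], [a9, a10, a11, a12], [a13, a14, a15, a16]]"
proof
  let ?r = "\<lambda>i j. [M $ (i, j) $ (0, 0), M $ (i, j) $ (0, 1), M $ (i, j) $ (1, 0), M $ (i, j) $ (1, 1)]"
  show "M = mat_of_rows4 [?r 0 0, ?r 0 1, ?r 1 0, ?r 1 1]"
    by (simp add: mat_of_rows4_expand numeral_eq_Suc)
qed

lemma tensor_gen_explicit:
  fixes q l1 e1 l2 e2 :: complex
  assumes "e1 \<in> {1, -1}" "e2 \<in> {1, -1}" "q \<noteq> 0"
  defines "k \<equiv> qstar q"
  shows "tensor_gen q l1 e1 l2 e2 (E 1) = mat_of_rows4
      [[0, e1 * l2, e2 * k * l1, 0], [0, 0, 0, - e2 * l1 / k], [0, 0, 0, - e1 * l2], [0, 0, 0, 0]]"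
    and "tensor_gen q l1 e1 l2 e2 (E 0) = mat_of_rows4
      [[0, 0, 0, 0], [e1 * l2, 0, 0, 0], [e2 * l1 / k, 0, 0, 0], [0, - e2 * k * l1, - e1 * l2, 0]]"
    and "tensor_gen q l1 e1 l2 e2 (F 1) = mat_of_rows4
      [[0, 0, 0, 0], [- \<i> * e2 / (k * l2), 0, 0, 0], [- \<i> * e1 / l1, 0, 0, 0],
       [0, - \<i> * e1 / l1, - \<i> * e2 * k / l2, 0]]"
    and "tensor_gen q l1 e1 l2 e2 (F 0) = mat_of_rows4
      [[0, \<i> * e2 * k / l2, \<i> * e1 / l1, 0], [0, 0, 0, \<i> * e1 / l1],
       [0, 0, 0, \<i> * e2 / (k * l2)], [0, 0, 0, 0]]"
    and "tensor_gen q l1 e1 l2 e2 (K 1) = mat_of_rows4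
      [[e1 * e2 * k^2, 0, 0, 0], [0, - e1 * e2, 0, 0], [0, 0, - e1 * e2, 0], [0, 0, 0, e1 * e2 / k^2]]"
    and "tensor_gen q l1 e1 l2 e2 (K 0) = mat_of_rows4
      [[e1 * e2 / k^2, 0, 0, 0], [0, - e1 * e2, 0, 0], [0, 0, - e1 * e2, 0], [0, 0, 0, e1 * e2 * k^2]]"
    and "tensor_gen q l1 e1 l2 e2 (Kinv 1) = mat_of_rows4
      [[e1 * e2 / k^2, 0, 0, 0], [0, - e1 * e2, 0, 0], [0, 0, - e1 * e2, 0], [0, 0, 0, e1 * e2 * k^2]]"
    and "tensor_gen q l1 e1 l2 e2 (Kinv 0) = mat_of_rows4
      [[e1 * e2 * k^2, 0, 0, 0], [0, - e1 * e2, 0, 0], [0, 0, - e1 * e2, 0], [0, 0, 0, e1 * e2 / k^2]]"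
proof -
  have "k \<noteq> 0"
    using assms(3) by (simp add: k_def qstar_def)
  have k: "qstar q = k"
    by (simp add: k_def)
  note defs = tensor_gen_def gn_def one_free_alg tens_single tensor_action_free_add
    tensor_action_free_single tensor_word_nth ev_gen_def bvec_nth Let_def k
    mat_of_rows4_expand numeral_eq_Suc mat_nth field_simps
  \<comment> \<open>An odd operator on the second factor acquires the sign \<open>e1\<close> on
    passing v_0 and \<open>- e1\<close> on passing v_1; this replaces the parity cases by
    factors.\<close>
  have e: "super_sign 1 (v_parity e1 0) = e1" "super_sign 1 (v_parity e1 1) = - e1"
    using assms(1) by (auto simp: v_parity_def super_sign_def)
  show "tensor_gen q l1 e1 l2 e2 (E 1) = mat_of_rows4
      [[0, e1 * l2, e2 * k * l1, 0], [0, 0, 0, - e2 * l1 / k], [0, 0, 0, - e1 * l2], [0, 0, 0, 0]]"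
    using assms(1,2) \<open>k \<noteq> 0\<close> e by (auto simp: defs)
  show "tensor_gen q l1 e1 l2 e2 (E 0) = mat_of_rows4
      [[0, 0, 0, 0], [e1 * l2, 0, 0, 0], [e2 * l1 / k, 0, 0, 0], [0, - e2 * k * l1, - e1 * l2, 0]]"
    using assms(1,2) \<open>k \<noteq> 0\<close> e by (auto simp: defs)
  show "tensor_gen q l1 e1 l2 e2 (F 1) = mat_of_rows4
      [[0, 0, 0, 0], [- \<i> * e2 / (k * l2), 0, 0, 0], [- \<i> * e1 / l1, 0, 0, 0],
       [0, - \<i> * e1 / l1, - \<i> * e2 * k / l2, 0]]"
    using assms(1,2) \<open>k \<noteq> 0\<close> e by (auto simp: defs)
  show "tensor_gen q l1 e1 l2 e2 (F 0) = mat_of_rows4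
      [[0, \<i> * e2 * k / l2, \<i> * e1 / l1, 0], [0, 0, 0, \<i> * e1 / l1],
       [0, 0, 0, \<i> * e2 / (k * l2)], [0, 0, 0, 0]]"
    using assms(1,2) \<open>k \<noteq> 0\<close> e by (auto simp: defs)
  show "tensor_gen q l1 e1 l2 e2 (K 1) = mat_of_rows4
      [[e1 * e2 * k^2, 0, 0, 0], [0, - e1 * e2, 0, 0], [0, 0, - e1 * e2, 0], [0, 0, 0, e1 * e2 / k^2]]"
    using assms(1,2) \<open>k \<noteq> 0\<close> by (auto simp: defs)
  show "tensor_gen q l1 e1 l2 e2 (K 0) = mat_of_rows4
      [[e1 * e2 / k^2, 0, 0, 0], [0, - e1 * e2, 0, 0], [0, 0, - e1 * e2, 0], [0, 0, 0, e1 * e2 * k^2]]"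
    using assms(1,2) \<open>k \<noteq> 0\<close> by (auto simp: defs)
  show "tensor_gen q l1 e1 l2 e2 (Kinv 1) = mat_of_rows4
      [[e1 * e2 / k^2, 0, 0, 0], [0, - e1 * e2, 0, 0], [0, 0, - e1 * e2, 0], [0, 0, 0, e1 * e2 * k^2]]"
    using assms(1,2) \<open>k \<noteq> 0\<close> by (auto simp: defs)
  show "tensor_gen q l1 e1 l2 e2 (Kinv 0) = mat_of_rows4
      [[e1 * e2 * k^2, 0, 0, 0], [0, - e1 * e2, 0, 0], [0, 0, - e1 * e2, 0], [0, 0, 0, e1 * e2 / k^2]]"
    using assms(1,2) \<open>k \<noteq> 0\<close> by (auto simp: defs)
qed

lemma uq_rep_ev_gen:
  assumes "q \<noteq> 0" "(qstar q)^2 \<noteq> 1" "l \<noteq> 0" "e \<in> {1, -1}"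
  shows "uq_rep q (ev_gen q l e)"
proof -
  define k where "k = qstar q"
  have k: "qstar q = k" "q = \<i> * k"
    by (simp_all add: k_def qstar_def)
  have "k \<noteq> 0" "k^2 \<noteq> 1"
    using assms(1,2) k by auto
  have powi: "q powi 2 = - (k^2)" "q powi (-2) = - (1 / k^2)"
    by (simp_all add: k(2) power_mult_distrib power_int_minus field_simps)
  have qq: "q * q = - (k * k)"
    by (simp add: k(2) power_mult_distrib flip: power2_eq_square)
  \<comment> \<open>With \<open>q\<close> equal to \<open>\<i> * k\<close>, the sum of
    \<open>q\<close> and its inverse is \<open>\<i> * (k^2 - 1) / k\<close>, which is
    nonzero.\<close>
  have EF: "1 / (q + inverse q) = - \<i> * k / (k^2 - 1)"
    using \<open>k \<noteq> 0\<close> \<open>k^2 \<noteq> 1\<close> by (simp add: k(2) field_simps power2_eq_square)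
  note defs = vec_eq_iff matrix_matrix_mult_def sum_bit ev_gen_def all_bit bvec_nth Let_def k(1)
    mat_matrix_mult_nth mat_nth cartan_def powi
  show ?thesis
    unfolding uq_rep_def
    using \<open>k \<noteq> 0\<close> \<open>k^2 \<noteq> 1\<close> assms(3,4)
    apply (intro conjI)
    subgoal by (auto simp: defs mat_nth)
    subgoal by (auto simp: defs)
    subgoal by (auto simp: defs field_simps power2_eq_square qq)
    subgoal by (auto simp: defs field_simps power2_eq_square qq)
    subgoal unfolding EF by (auto simp: defs field_simps power2_eq_square)
    \<comment> \<open>Each \<open>E i\<close> and each \<open>F i\<close> has square 0 on the
      evaluation module. If A has square 0, the middle commutator is a multiple of ABA, which A
      annihilates from both sides.\<close>
    subgoal by (auto simp: matrix_serre_def matrix_qcomm_def defs)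
    subgoal by (auto simp: matrix_serre_def matrix_qcomm_def defs)
    done
qed

text \<open>The check on explicit matrices shows that, on this tensor product, the action through
  the coproduct passes from the free algebra to \<open>uq q\<close>.\<close>

lemma uq_rep_tensor_gen:
  assumes "q \<noteq> 0" "(qstar q)^2 \<noteq> 1" "l1 \<noteq> 0" "e1 \<in> {1, -1}" "l2 \<noteq> 0" "e2 \<in> {1, -1}"
  shows "uq_rep q (tensor_gen q l1 e1 l2 e2)"
proof -
  define k where "k = qstar q"
  have k: "qstar q = k" "q = \<i> * k"
    by (simp_all add: k_def qstar_def)
  have "k \<noteq> 0" "k^2 \<noteq> 1"
    using assms(1,2) k by auto
  have powi: "q powi 2 = - (k^2)" "q powi (-2) = - (1 / k^2)"
    by (simp_all add: k(2) power_mult_distrib power_int_minus field_simps)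
  have qq: "q * q = - (k * k)"
    by (simp add: k(2) power_mult_distrib flip: power2_eq_square)
  have EF: "1 / (q + inverse q) = - \<i> * k / (k^2 - 1)"
    using \<open>k \<noteq> 0\<close> \<open>k^2 \<noteq> 1\<close> by (simp add: k(2) field_simps power2_eq_square)
  \<comment> \<open>The forms with \<open>x\<close> cancel a repeated sign inside a product that is
    bracketed to the right.\<close>
  have e: "e1 * e1 = 1" "e2 * e2 = 1" "e1 * (e1 * x) = x" "e2 * (e2 * x) = x" for x
    using assms(4,6) by auto
  note defs = tensor_gen_explicit[OF assms(4,6,1), unfolded k(1)] all_bit cartan_def powi
    mat_of_rows4_eq_iff mat_of_rows4_mult mat_of_rows4_add mat_of_rows4_diff
    mat_of_rows4_mat mat_of_rows4_zero
  show ?thesis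
    unfolding uq_rep_def
    using \<open>k \<noteq> 0\<close> \<open>k^2 \<noteq> 1\<close> assms(3,5)
    apply (intro conjI)
    subgoal by (simp add: defs e mult_ac)
    subgoal by (simp add: defs)
    subgoal by (simp add: defs field_simps power2_eq_square qq)
    subgoal by (simp add: defs field_simps power2_eq_square qq)
    subgoal unfolding EF by (simp add: defs field_simps power2_eq_square e)
    \<comment> \<open>Three factors move the weight one way and one moves it back, so only a corner
      entry of the matrix can be nonzero, which leaves one scalar identity.\<close>
    subgoal unfolding matrix_serre_def matrix_qcomm_def powi
      by (simp add: defs field_simps power2_eq_square e qq)
    subgoal unfolding matrix_serre_def matrix_qcomm_def powi
      by (simp add: defs field_simps power2_eq_square e qq)
    done
qed

section \<open>Intertwiners\<close>

lemma all_gen: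
  "(\<forall>g. P g) \<longleftrightarrow> P (E 0) \<and> P (E 1) \<and> P (F 0) \<and> P (F 1)
     \<and> P (K 0) \<and> P (K 1) \<and> P (Kinv 0) \<and> P (Kinv 1)"
proof
  assume "P (E 0) \<and> P (E 1) \<and> P (F 0) \<and> P (F 1) \<and> P (K 0) \<and> P (K 1) \<and> P (Kinv 0) \<and> P (Kinv 1)"
  then have "P (E i)" "P (F i)" "P (K i)" "P (Kinv i)" for i
    by (cases i; simp)+
  then show "\<forall>g. P g"
    by (metis gen.exhaust)
qed simp

text \<open>The unknowns are the weight-preserving entries: \<open>a\<close> and \<open>f\<close> at
  the ends, and the middle block with rows \<open>b\<close>, \<open>c\<close> and \<open>d\<close>,
  \<open>e\<close>. The scale \<open>t\<close> is read off from \<open>d\<close>, whose model entry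
  \<open>e1 * z * (1 - k^2)\<close> is never 0, whereas diagonal entries can vanish.\<close>

lemma intertwiner_system:
  fixes a b c d e f k z e1 e2 :: complex
  assumes "e1 \<in> {1, -1}" "e2 \<in> {1, -1}" "k \<noteq> 0" "z \<noteq> 0" "k^2 \<noteq> 1" "k^2 \<noteq> -1"
    and h1: "k * z * b + d = e1 * z * a" and h2: "k * z * c + e = e2 * k * a"
    and h3: "k * f = - e2 * b - e1 * k * z * c" and h4: "z * f = - e2 * d - e1 * z * k * e"
    and h5: "z * a = e1 * k * z * b + e2 * c"
  defines "t \<equiv> e1 * d / (z * (1 - k^2))"
  shows "a = t * (1 - z^2 * k^2)" "b = t * (e1 * k * (1 - z^2))" "c = t * (e2 * z * (1 - k^2))"
    "d = t * (e1 * z * (1 - k^2))" "e = t * (e2 * k * (1 - z^2))" "f = t * (- e1 * e2 * (1 - z^2 * k^2))"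
proof -
  have e: "e1 * e1 = 1" "e2 * e2 = 1"
    using assms(1,2) by auto
  have t: "t * (z * (1 - k^2)) = e1 * d"
    using assms(4,5) by (simp add: t_def)
  show d: "d = t * (e1 * z * (1 - k^2))"
    using t e by Groebner_Basis.algebra
  \<comment> \<open>\<open>h1\<close> times \<open>e1\<close> and \<open>h5\<close> agree in the
    terms with \<open>a\<close> and \<open>b\<close>, so \<open>e2 * c = e1 * d\<close>.\<close>
  show c: "c = t * (e2 * z * (1 - k^2))"
    using t e h1 h5 by Groebner_Basis.algebra
  \<comment> \<open>Eliminating \<open>f\<close>, \<open>b\<close> and \<open>e\<close> from
    \<open>h1\<close> to \<open>h4\<close> gives \<open>z * (1 - k^4) * a\<close> as
    \<open>1 + k^2\<close> times a combination of \<open>c\<close> and \<open>d\<close>. Cancelling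
    this factor uses that \<open>k^2\<close> is not -1.\<close>
  have "z * (1 - k^2) * (1 + k^2) * (a - t * (1 - z^2 * k^2)) = 0"
    using e c d h1 h2 h3 h4 by Groebner_Basis.algebra
  then show a: "a = t * (1 - z^2 * k^2)"
    using assms(4-6) by (auto simp: eq_neg_iff_add_eq_0 add.commute)
  have "k * z * (b - t * (e1 * k * (1 - z^2))) = 0"
    using e a d h1 by Groebner_Basis.algebra
  then show b: "b = t * (e1 * k * (1 - z^2))"
    using assms(3,4) by simp
  show e': "e = t * (e2 * k * (1 - z^2))"
    using e a c h2 by Groebner_Basis.algebra
  have "k * (f - t * (- e1 * e2 * (1 - z^2 * k^2))) = 0"
    using e b c h3 by Groebner_Basis.algebra
  then show "f = t * (- e1 * e2 * (1 - z^2 * k^2))"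
    using assms(3) by (simp add: eq_neg_iff_add_eq_0)
qed

definition R_mat :: "complex \<Rightarrow> complex \<Rightarrow> complex \<Rightarrow> complex \<Rightarrow> complex ^ (bit \<times> bit) ^ (bit \<times> bit)" where
  "R_mat k z e1 e2 = mat_of_rows4
     [[1 - z^2 * k^2, 0, 0, 0],
      [0, e1 * k * (1 - z^2), e2 * z * (1 - k^2), 0],
      [0, e1 * z * (1 - k^2), e2 * k * (1 - z^2), 0],
      [0, 0, 0, - e1 * e2 * (1 - z^2 * k^2)]]"

text \<open>The off-diagonal entry \<open>e1 * z * (1 - k^2)\<close> is nonzero, also where some
  diagonal entries vanish.\<close>

lemma R_mat_nonzero:
  assumes "z \<noteq> 0" "k^2 \<noteq> 1" "e1 \<in> {1, -1}"
  shows "R_mat k z e1 e2 \<noteq> 0"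
  using assms by (auto simp: R_mat_def mat_of_rows4_zero mat_of_rows4_eq_iff)

lemma R_mat_intertwines:
  assumes "q \<noteq> 0" "l1 \<noteq> 0" "e1 \<in> {1, -1}" "l2 \<noteq> 0" "e2 \<in> {1, -1}"
  defines "N \<equiv> R_mat (qstar q) (l2 / l1) e1 e2"
  shows "flip_conj e1 e2 (tensor_gen q l2 e2 l1 e1 g) ** N = N ** tensor_gen q l1 e1 l2 e2 g"
proof -
  have "qstar q \<noteq> 0"
    using assms(1) by (simp add: qstar_def)
  have e: "e1 * e1 = 1" "e2 * e2 = 1" "e1 * (e1 * x) = x" "e2 * (e2 * x) = x" for x
    using assms(3,5) by auto
  have "\<forall>g. flip_conj e1 e2 (tensor_gen q l2 e2 l1 e1 g) ** N = N ** tensor_gen q l1 e1 l2 e2 g"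
    unfolding all_gen using \<open>qstar q \<noteq> 0\<close> assms(2,4)
    by (simp add: N_def R_mat_def tensor_gen_explicit[OF assms(3,5,1)]
        tensor_gen_explicit[OF assms(5,3,1)] flip_conj_mat_of_rows4[OF assms(3,5)]
        mat_of_rows4_mult mat_of_rows4_eq_iff field_simps power2_eq_square e)
  then show ?thesis ..
qed

lemma intertwiner_eq_R_mat:
  assumes "q \<noteq> 0" "l1 \<noteq> 0" "e1 \<in> {1, -1}" "l2 \<noteq> 0" "e2 \<in> {1, -1}"
    and "(qstar q)^2 \<noteq> 1" "(qstar q)^2 \<noteq> -1"
    and M: "\<And>g. flip_conj e1 e2 (tensor_gen q l2 e2 l1 e1 g) ** M = M ** tensor_gen q l1 e1 l2 e2 g"
  shows "\<exists>t. M = mat t ** R_mat (qstar q) (l2 / l1) e1 e2"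
proof -
  define k where "k = qstar q"
  define z where "z = l2 / l1"
  have k0: "k \<noteq> 0" "k^2 \<noteq> 1" "k^2 \<noteq> -1"
    using assms(1,6,7) by (simp_all add: k_def qstar_def)
  have l2: "l2 = z * l1" "z \<noteq> 0"
    using assms(2,4) by (simp_all add: z_def)
  have e: "e1 * e1 = 1" "e2 * e2 = 1" "e1 * (e1 * x) = x" "e2 * (e2 * x) = x" "e1 \<noteq> 0" "e2 \<noteq> 0" for x
    using assms(3,5) by auto
  obtain a1 a2 a3 a4 a5 a6 a7 a8 a9 a10 a11 a12 a13 a14 a15 a16 where Ma:
    "M = mat_of_rows4 [[a1, a2, a3, a4], [a5, a6, a7, a8], [a9, a10, a11, a12], [a13, a14, a15, a16]]"
    by (rule mat_of_rows4_cases)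
  note defs = Ma tensor_gen_explicit[OF assms(3,5,1), folded k_def]
    tensor_gen_explicit[OF assms(5,3,1), folded k_def] flip_conj_mat_of_rows4[OF assms(3,5)]
    mat_of_rows4_mult mat_of_rows4_eq_iff
  have k_plus: "k^2 + 1 \<noteq> 0"
    using k0(3) by (simp add: eq_neg_iff_add_eq_0)
  \<comment> \<open>The eigenvalues of \<open>K 1\<close> on the three weight spaces, of dimensions
    1, 2 and 1.\<close>
  define p m r where "p = e1 * e2 * k^2" and "m = - e1 * e2" and "r = e1 * e2 / k^2"
  have pmr: "p \<noteq> m" "r \<noteq> m" "p \<noteq> r"
  proof -
    have "p - m = e1 * e2 * (k^2 + 1)" "k^2 * (r - m) = e1 * e2 * (k^2 + 1)"
      "k^2 * (p - r) = e1 * e2 * (k^2 + 1) * (k^2 - 1)"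
      using k0(1) by (simp_all add: p_def m_def r_def algebra_simps power2_eq_square)
    then show "p \<noteq> m" "r \<noteq> m" "p \<noteq> r"
      using k0 k_plus e(5,6) by auto
  qed
  have cancel: "u * x = x * v \<longleftrightarrow> x = 0" if "u \<noteq> v" for u v x :: complex
    using that by (simp add: mult.commute[of x])
  let ?D = "mat_of_rows4 [[p, 0, 0, 0], [0, m, 0, 0], [0, 0, m, 0], [0, 0, 0, r]]"
  \<comment> \<open>The two middle entries coincide, so the flip leaves the matrix of
    \<open>K 1\<close> unchanged and the intertwining condition becomes commutation. Entries of
    \<open>M\<close> between different eigenspaces must then vanish.\<close>
  have "?D ** M = M ** ?D"
    using M[of "K 1"] by (simp add: tensor_gen_explicit[OF assms(3,5,1), folded k_def]
        tensor_gen_explicit[OF assms(5,3,1), folded k_def] flip_conj_mat_of_rows4[OF assms(3,5)]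
        p_def m_def r_def mult.commute)
  then have zeros: "a2 = 0 \<and> a3 = 0 \<and> a4 = 0 \<and> a5 = 0 \<and> a8 = 0 \<and> a9 = 0 \<and> a12 = 0
      \<and> a13 = 0 \<and> a14 = 0 \<and> a15 = 0"
    using pmr pmr[symmetric] by (simp add: Ma mat_of_rows4_mult mat_of_rows4_eq_iff cancel)
  \<comment> \<open>These are the entries of the equation for \<open>E 1\<close> in the first row
    and the last column. The common factor \<open>l1\<close> remains from writing \<open>l2\<close>
    as \<open>z * l1\<close> and is cancelled below.\<close>
  have "l1 * (k * z * a6 + a10) = l1 * (e1 * z * a1)" "l1 * (k * z * a7 + a11) = l1 * (e2 * k * a1)"
    "l1 * (k * a16) = l1 * (- e2 * a6 - e1 * k * z * a7)"
    "l1 * (z * a16) = l1 * (- e2 * a10 - e1 * z * k * a11)"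
    using M[of "E 1"] k0(1) l2(2) assms(2)
    by (simp_all add: defs zeros l2(1) field_simps e eq_neg_iff_add_eq_0)
  moreover have "l1 * (z * a1) = l1 * (e1 * k * z * a6 + e2 * a7)"
    using M[of "E 0"] k0(1) l2(2) assms(2)
    by (simp add: defs zeros l2(1) field_simps e)
  ultimately have "M = mat (e1 * a10 / (z * (1 - k^2))) ** R_mat k z e1 e2"
    using intertwiner_system[OF assms(3,5) k0(1) l2(2) k0(2,3), of a6 a10 a1 a7 a11 a16] zeros assms(2)
    by (simp add: Ma R_mat_def mat_of_rows4_mat mat_of_rows4_mult mat_of_rows4_eq_iff)
  then show ?thesis
    unfolding k_def z_def by blast
qed

lemma mat_mult_vector: "(mat t ** N) *v u = t *s (N *v u)" for N :: "complex ^ 'n ^ 'm"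
  by (simp add: vec_eq_iff matrix_vector_mult_def mat_matrix_mult_nth sum_distrib_left mult.assoc)

lemma equal_up_to_scalar_mat:
  assumes "t \<noteq> 0"
  shows "equal_up_to_scalar R (mat t ** N) \<longleftrightarrow> equal_up_to_scalar R N"
proof
  assume "equal_up_to_scalar R (mat t ** N)"
  then obtain c where "c \<noteq> 0" "\<And>u. R u = c *s ((mat t ** N) *v u)"
    by (auto simp: equal_up_to_scalar_def)
  with assms show "equal_up_to_scalar R N"
    unfolding equal_up_to_scalar_def
    by (intro exI[of _ "c * t"]) (simp add: mat_mult_vector)
next
  assume "equal_up_to_scalar R N"
  then obtain c where "c \<noteq> 0" "\<And>u. R u = c *s (N *v u)"
    by (auto simp: equal_up_to_scalar_def)
  with assms show "equal_up_to_scalar R (mat t ** N)"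
    unfolding equal_up_to_scalar_def
    by (intro exI[of _ "c / t"]) (simp add: mat_mult_vector)
qed

text \<open>The intertwiners are exactly the scalar multiples of \<open>R_mat\<close>. As
  \<open>R_mat\<close> is nonzero, an intertwiner is nonzero exactly when its scalar is.\<close>

lemma is_R_matrix_iff_R_mat:
  assumes "q \<noteq> 0" "(qstar q)^2 \<noteq> 1" "(qstar q)^2 \<noteq> -1"
    and "l1 \<noteq> 0" "e1 \<in> {1, -1}" "l2 \<noteq> 0" "e2 \<in> {1, -1}"
  shows "is_R_matrix q l1 e1 l2 e2 R \<longleftrightarrow> equal_up_to_scalar R (R_mat (qstar q) (l2 / l1) e1 e2)"
    (is "_ \<longleftrightarrow> equal_up_to_scalar R ?N")
proof -
  have nonzero: "mat t ** ?N \<noteq> 0 \<longleftrightarrow> t \<noteq> 0" for t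
    using R_mat_nonzero[of "l2 / l1" "qstar q" e1 e2] assms
    by (auto simp: vec_eq_iff mat_matrix_mult_nth)
  have intertwines: "(\<forall>g. flip_conj e1 e2 (tensor_gen q l2 e2 l1 e1 g) ** M = M ** tensor_gen q l1 e1 l2 e2 g)
      \<longleftrightarrow> (\<exists>t. M = mat t ** ?N)" for M
  proof
    assume "\<forall>g. flip_conj e1 e2 (tensor_gen q l2 e2 l1 e1 g) ** M = M ** tensor_gen q l1 e1 l2 e2 g"
    then show "\<exists>t. M = mat t ** ?N"
      using assms by (intro intertwiner_eq_R_mat) auto
  next
    assume "\<exists>t. M = mat t ** ?N"
    then obtain t where t: "M = mat t ** ?N" ..
    have "flip_conj e1 e2 (tensor_gen q l2 e2 l1 e1 g) ** M
        = mat t ** (flip_conj e1 e2 (tensor_gen q l2 e2 l1 e1 g) ** ?N)" for g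
      unfolding t matrix_mul_assoc mat_matrix_mult_commute[of t "flip_conj _ _ _"] ..
    also have "\<dots> g = M ** tensor_gen q l1 e1 l2 e2 g" for g
      unfolding t using R_mat_intertwines[of q l1 e1 l2 e2 g] assms by (simp add: matrix_mul_assoc)
    finally show "\<forall>g. flip_conj e1 e2 (tensor_gen q l2 e2 l1 e1 g) ** M = M ** tensor_gen q l1 e1 l2 e2 g"
      by blast
  qed
  have "is_R_matrix q l1 e1 l2 e2 R \<longleftrightarrow> (\<exists>M. R = (*v) M \<and> M \<noteq> 0 \<and> (\<exists>t. M = mat t ** ?N))"
    using is_R_matrix_iff[of e1 e2 q l1 l2 R] assms intertwines
    by (simp add: uq_rep_ev_gen uq_rep_tensor_gen)
  also have "\<dots> \<longleftrightarrow> (\<exists>t. t \<noteq> 0 \<and> R = (*v) (mat t ** ?N))"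
    using nonzero by blast
  also have "\<dots> \<longleftrightarrow> equal_up_to_scalar R ?N"
    by (simp add: equal_up_to_scalar_def fun_eq_iff mat_mult_vector)
  finally show ?thesis .
qed

theorem proposition3p2:
  fixes q qs l1 l2 \<epsilon>1 \<epsilon>2 z :: complex
  assumes "q \<noteq> 0"
    and "qs = qstar q"
    and "\<forall>n::nat. n > 0 \<longrightarrow> qs ^ n \<noteq> 1"
    and "l1 \<noteq> 0" and "l2 \<noteq> 0"
    and "\<epsilon>1 \<in> {1, -1}" and "\<epsilon>2 \<in> {1, -1}"
    and "z = l2 / l1"
  shows "(\<forall>R. is_R_matrix q l1 \<epsilon>1 l2 \<epsilon>2 R \<longleftrightarrow>
            equal_up_to_scalar R (mat_of_rows4
              [[1 - z^2 * qs^2, 0, 0, 0],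
               [0, \<epsilon>1 * qs * (1 - z^2), \<epsilon>2 * z * (1 - qs^2), 0],
               [0, \<epsilon>1 * z * (1 - qs^2), \<epsilon>2 * qs * (1 - z^2), 0],
               [0, 0, 0, - \<epsilon>1 * \<epsilon>2 * (1 - z^2 * qs^2)]]))
       \<and> (\<forall>x1 x2 lnqs :: complex.
            l1 = exp x1 \<and> l2 = exp x2 \<and> qs = exp lnqs \<longrightarrow>
            (\<forall>R. is_R_matrix q l1 \<epsilon>1 l2 \<epsilon>2 R \<longleftrightarrow>
              equal_up_to_scalar R (mat_of_rows4
                [[sinh (x1 - x2 - lnqs), 0, 0, 0],
                 [0, \<epsilon>1 * sinh (x1 - x2), - \<epsilon>2 * sinh lnqs, 0],
                 [0, - \<epsilon>1 * sinh lnqs, \<epsilon>2 * sinh (x1 - x2), 0],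
                 [0, 0, 0, - \<epsilon>1 * \<epsilon>2 * sinh (x1 - x2 - lnqs)]])))"
proof -
  \<comment> \<open>Excluding roots of unity of orders 2 and 4 makes the three eigenvalues of
    \<open>K 1\<close> distinct.\<close>
  have "qs^2 \<noteq> 1"
    using assms(3) by simp
  moreover have "qs^2 \<noteq> -1"
  proof
    assume "qs^2 = -1"
    then have "(qs^2)^2 = 1" by simp
    then show False using assms(3) by (simp flip: power_mult)
  qed
  ultimately have main: "is_R_matrix q l1 \<epsilon>1 l2 \<epsilon>2 R \<longleftrightarrow> equal_up_to_scalar R (R_mat qs z \<epsilon>1 \<epsilon>2)" for R
    using is_R_matrix_iff_R_mat[of q l1 \<epsilon>1 l2 \<epsilon>2 R] assms by simp
  have "z \<noteq> 0" "qs \<noteq> 0"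
    using assms(1,2,4,5,8) by (simp_all add: qstar_def)
  \<comment> \<open>Since \<open>exp (x1 - x2)\<close> is \<open>1 / z\<close>, twice the first
    hyperbolic sine is \<open>1 / (z * qs) - z * qs\<close>, which yields the factor
    \<open>1 / (2 * z * qs)\<close>. Only exponentials enter, so any logarithm of \<open>qs\<close>
    serves.\<close>
  have "mat_of_rows4 [[sinh (x1 - x2 - lnqs), 0, 0, 0],
                 [0, \<epsilon>1 * sinh (x1 - x2), - \<epsilon>2 * sinh lnqs, 0],
                 [0, - \<epsilon>1 * sinh lnqs, \<epsilon>2 * sinh (x1 - x2), 0],
                 [0, 0, 0, - \<epsilon>1 * \<epsilon>2 * sinh (x1 - x2 - lnqs)]]
      = mat (1 / (2 * z * qs)) ** R_mat qs z \<epsilon>1 \<epsilon>2"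
    if "l1 = exp x1 \<and> l2 = exp x2 \<and> qs = exp lnqs" for x1 x2 lnqs
  proof -
    have exp1: "exp (x1 - x2) = 1 / z" and exp2: "exp (x1 - x2 - lnqs) = 1 / (z * qs)"
      and exp3: "exp lnqs = qs"
      using that assms(8) by (simp_all add: exp_diff)
    have "sinh (x1 - x2 - lnqs) = 1 / (2 * z * qs) * (1 - z^2 * qs^2)"
      "sinh (x1 - x2) = 1 / (2 * z * qs) * (qs * (1 - z^2))"
      "sinh lnqs = - (1 / (2 * z * qs) * (z * (1 - qs^2)))"
      unfolding sinh_field_def exp_minus exp1 exp2 exp3
      using \<open>z \<noteq> 0\<close> \<open>qs \<noteq> 0\<close> by (simp_all add: field_simps power2_eq_square)
    then show ?thesis
      by (simp add: R_mat_def mat_of_rows4_mat mat_of_rows4_mult mat_of_rows4_eq_iff)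
  qed
  moreover have "1 / (2 * z * qs) \<noteq> 0"
    using \<open>z \<noteq> 0\<close> \<open>qs \<noteq> 0\<close> by simp
  ultimately show ?thesis
    using main by (auto simp: R_mat_def equal_up_to_scalar_mat)
qed

end
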